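(* Let $R$ be a commutative noetherian domain, let $f:A\to B$ be a homomorphism of $R$-torsion-free $R$-algebras, and assume that $B$ is finite (finitely generated as a module) over $R$. Let $\omega:\mathrm{mod}_{\rm f}(B)\to\mathrm{mod}_{\rm f}(A)$ be the functor induced by $f$. Then: (1) The image of $\omega$ is closed under taking saturated subobjects of $R$-torsion-free objects if and only if $f$ is dominant. In this case the image of $\omega$ is also closed under taking saturated submodules of any modules, and the restriction of $\omega$ to the full subcategory of $R$-torsion-free $B$-modules is full. (2) The image of $\omega$ is closed under taking subobjects of $R$-torsion-free objects if and only if $f$ is surjective. In this case $\omega$ is also full.
   Context: Algebras are associative and unital, not necessarily commutative; homomorphisms preserve units. For an algebra $A$, $\mathrm{mod}_{\rm f}(A)$ is the category of finitely generated left $A$-modules. Modules over an $R$-algebra are automatically $R$-modules; such a module (or algebra) is called $R$-torsion-free if it is torsion-free as an $R$-module. The functor $\omega$ is restriction of scalars along $f$ (the identity on underlying $R$-modules). Let $K$ be the quotient field of $R$. The homomorphism $f:A\to B$ is called dominant if $f\otimes_R K:A\otimes_R K\to B\otimes_R K$ is surjective; equivalently, $B/f(A)$ is $R$-torsion. An $A$-submodule $N$ of an $A$-module $M$ is called saturated if $M/N$ is $R$-torsion-free. "The image of $\omega$ is closed under taking subobjects (resp. saturated subobjects) of objects of a certain class" means: for every $M\in\mathrm{mod}_{\rm f}(B)$ in that class and every $A$-submodule (resp. saturated $A$-submodule) $N$ of $\omega(M)$, there is a $B$-submodule $M'$ of $M$ with $\omega(M')=N$, i.e. $N$ is stable under the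 action of $B$ on $M$. *)

theory Defs
  imports "HOL-Algebra.Algebra"
begin

section \<open>Algebras and modules over non-commutative rings\<close>

text \<open>
  The library locales \<open>module\<close> and \<open>algebra\<close> require a commutative ring of scalars and a commutative
  algebra, respectively. The variants below drop these requirements; the records and the library
  notion \<open>submodule\<close>, which does not depend on commutativity, are reused. As in the library, a module
  is an element of the record type of algebras whose fields \<open>mult\<close> and \<open>one\<close> carry no meaning.
\<close>

locale left_module = S?: ring S + M?: abelian_group M for S :: "('a, 'x) ring_scheme" (structure)
    and M :: "('a, 'm, 'y) module_scheme" (structure) +
  assumes smult_closed:
      "\<lbrakk>a \<in> carrier S; x \<in> carrier M\<rbrakk> \<Longrightarrow> a \<odot>\<^bsub>M\<^esub> x \<in> carrier M"
    and smult_l_distr: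
      "\<lbrakk>a \<in> carrier S; b \<in> carrier S; x \<in> carrier M\<rbrakk> \<Longrightarrow>
        (a \<oplus>\<^bsub>S\<^esub> b) \<odot>\<^bsub>M\<^esub> x = a \<odot>\<^bsub>M\<^esub> x \<oplus>\<^bsub>M\<^esub> b \<odot>\<^bsub>M\<^esub> x"
    and smult_r_distr:
      "\<lbrakk>a \<in> carrier S; x \<in> carrier M; y \<in> carrier M\<rbrakk> \<Longrightarrow>
        a \<odot>\<^bsub>M\<^esub> (x \<oplus>\<^bsub>M\<^esub> y) = a \<odot>\<^bsub>M\<^esub> x \<oplus>\<^bsub>M\<^esub> a \<odot>\<^bsub>M\<^esub> y"
    and smult_assoc1:
      "\<lbrakk>a \<in> carrier S; b \<in> carrier S; x \<in> carrier M\<rbrakk> \<Longrightarrow>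
        (a \<otimes>\<^bsub>S\<^esub> b) \<odot>\<^bsub>M\<^esub> x = a \<odot>\<^bsub>M\<^esub> (b \<odot>\<^bsub>M\<^esub> x)"
    and smult_one:
      "x \<in> carrier M \<Longrightarrow> \<one>\<^bsub>S\<^esub> \<odot>\<^bsub>M\<^esub> x = x"

locale assoc_algebra = module R A + A?: ring A for R :: "('r, 'x) ring_scheme" (structure)
    and A :: "('r, 'a, 'y) module_scheme" (structure) +
  assumes smult_assoc2:
      "\<lbrakk>r \<in> carrier R; x \<in> carrier A; y \<in> carrier A\<rbrakk> \<Longrightarrow>
        (r \<odot>\<^bsub>A\<^esub> x) \<otimes>\<^bsub>A\<^esub> y = r \<odot>\<^bsub>A\<^esub> (x \<otimes>\<^bsub>A\<^esub> y)"
    and smult_assoc3: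
      "\<lbrakk>r \<in> carrier R; x \<in> carrier A; y \<in> carrier A\<rbrakk> \<Longrightarrow>
        x \<otimes>\<^bsub>A\<^esub> (r \<odot>\<^bsub>A\<^esub> y) = r \<odot>\<^bsub>A\<^esub> (x \<otimes>\<^bsub>A\<^esub> y)"

definition algebra_hom ::
    "('r, 'x) ring_scheme \<Rightarrow> ('r, 'a) module \<Rightarrow> ('r, 'b) module \<Rightarrow> ('a \<Rightarrow> 'b) set" where
  "algebra_hom R A B =
    {f \<in> ring_hom A B. \<forall>r\<in>carrier R. \<forall>x\<in>carrier A. f (r \<odot>\<^bsub>A\<^esub> x) = r \<odot>\<^bsub>B\<^esub> f x}"

definition module_hom ::
    "('a, 'x) ring_scheme \<Rightarrow> ('a, 'm) module \<Rightarrow> ('a, 'n) module \<Rightarrow> ('m \<Rightarrow> 'n) set" where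
  "module_hom S M N =
    {h \<in> hom (add_monoid M) (add_monoid N).
      \<forall>a\<in>carrier S. \<forall>x\<in>carrier M. h (a \<odot>\<^bsub>M\<^esub> x) = a \<odot>\<^bsub>N\<^esub> h x}"

definition finitely_generated :: "('a, 'x) ring_scheme \<Rightarrow> ('a, 'm) module \<Rightarrow> bool" where
  "finitely_generated S M \<longleftrightarrow>
    (\<exists>G\<subseteq>carrier M. finite G \<and> carrier M = \<Inter>{N. submodule N S M \<and> G \<subseteq> N})"

text \<open>
  The objects of the category of finitely generated left \<open>S\<close>-modules, with carriers in the type \<open>'m\<close>.
\<close>

definition mod_f :: "('a, 'x) ring_scheme \<Rightarrow> ('a, 'm) module set" where
  "mod_f S = {M. left_module S M \<and> finitely_generated S M}"

definition restrict_scalars :: "('a \<Rightarrow> 'b) \<Rightarrow> ('b, 'm) module \<Rightarrow> ('a, 'm) module" where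
  "restrict_scalars f M =
    \<lparr>carrier = carrier M, monoid.mult = monoid.mult M, one = one M, ring.zero = ring.zero M, ring.add = ring.add M,
     smult = (\<lambda>a. module.smult M (f a))\<rparr>"

definition quotient_module :: "('a, 'm) module \<Rightarrow> 'm set \<Rightarrow> ('a, 'm set) module" where
  "quotient_module M N =
    \<lparr>carrier = a_rcosets\<^bsub>M\<^esub> N, monoid.mult = undefined, one = undefined, ring.zero = N, ring.add = set_add M,
     smult = (\<lambda>a C. \<Union>x\<in>C. N +>\<^bsub>M\<^esub> (a \<odot>\<^bsub>M\<^esub> x))\<rparr>"

definition torsion_free :: "('r, 'x) ring_scheme \<Rightarrow> ('r, 'm) module \<Rightarrow> bool" where
  "torsion_free R M \<longleftrightarrow>
    (\<forall>r\<in>carrier R. \<forall>x\<in>carrier M. r \<odot>\<^bsub>M\<^esub> x = \<zero>\<^bsub>M\<^esub> \<longrightarrow> r = \<zero>\<^bsub>R\<^esub> \<or> x = \<zero>\<^bsub>M\<^esub>)"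

text \<open>
  A module over an \<open>R\<close>-algebra \<open>A\<close> is an \<open>R\<close>-module by restriction along the structure map
  \<open>R \<rightarrow> A\<close>, \<open>r \<mapsto> r \<cdot> 1\<close>.
\<close>

definition base_module :: "('r, 'a) module \<Rightarrow> ('a, 'm) module \<Rightarrow> ('r, 'm) module" where
  "base_module A = restrict_scalars (\<lambda>r. r \<odot>\<^bsub>A\<^esub> \<one>\<^bsub>A\<^esub>)"

definition saturated_submodule ::
    "('r, 'x) ring_scheme \<Rightarrow> 'm set \<Rightarrow> ('r, 'a) module \<Rightarrow> ('a, 'm) module \<Rightarrow> bool" where
  "saturated_submodule R N A M \<longleftrightarrow>
    submodule N A M \<and> torsion_free R (base_module A (quotient_module M N))"

definition mod_tf :: "('r, 'x) ring_scheme \<Rightarrow> ('r, 'b) module \<Rightarrow> ('b, 'm) module set" where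
  "mod_tf R B = {M \<in> mod_f B. torsion_free R (base_module B M)}"

section \<open>Tensor products and dominant homomorphisms\<close>

text \<open>
  The tensor product of modules over a commutative ring, as an abelian group (written
  multiplicatively, like \<open>free_Abelian_group\<close>): the free abelian group on pairs modulo the
  bilinearity relations.
\<close>

definition tensor_relations ::
    "('r, 'x) ring_scheme \<Rightarrow> ('r, 'm) module \<Rightarrow> ('r, 'n) module \<Rightarrow> ('m \<times> 'n \<Rightarrow>\<^sub>0 int) set" where
  "tensor_relations R M N =
    {frag_of (x \<oplus>\<^bsub>M\<^esub> x', y) - frag_of (x, y) - frag_of (x', y) | x x' y.
      x \<in> carrier M \<and> x' \<in> carrier M \<and> y \<in> carrier N} \<union>
    {frag_of (x, y \<oplus>\<^bsub>N\<^esub> y') - frag_of (x, y) - frag_of (x, y') | x y y'.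
      x \<in> carrier M \<and> y \<in> carrier N \<and> y' \<in> carrier N} \<union>
    {frag_of (r \<odot>\<^bsub>M\<^esub> x, y) - frag_of (x, r \<odot>\<^bsub>N\<^esub> y) | r x y.
      r \<in> carrier R \<and> x \<in> carrier M \<and> y \<in> carrier N}"

definition tensor_kernel ::
    "('r, 'x) ring_scheme \<Rightarrow> ('r, 'm) module \<Rightarrow> ('r, 'n) module \<Rightarrow> ('m \<times> 'n \<Rightarrow>\<^sub>0 int) set" where
  "tensor_kernel R M N =
    generate (free_Abelian_group (carrier M \<times> carrier N)) (tensor_relations R M N)"

definition tensor_product ::
    "('r, 'x) ring_scheme \<Rightarrow> ('r, 'm) module \<Rightarrow> ('r, 'n) module \<Rightarrow>
      ('m \<times> 'n \<Rightarrow>\<^sub>0 int) set monoid" where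
  "tensor_product R M N =
    free_Abelian_group (carrier M \<times> carrier N) Mod tensor_kernel R M N"

text \<open>
  For \<open>f : M \<rightarrow> M'\<close>, the map from the tensor product of \<open>M\<close> and \<open>N\<close> to that of \<open>M'\<close> and \<open>N\<close> induced
  by \<open>(x, y) \<mapsto> (f x, y)\<close>. On a coset \<open>C\<close> the union below is that of equal cosets.
\<close>

definition tensor_map ::
    "('r, 'x) ring_scheme \<Rightarrow> ('m \<Rightarrow> 'm') \<Rightarrow> ('r, 'm') module \<Rightarrow> ('r, 'n) module \<Rightarrow>
      ('m \<times> 'n \<Rightarrow>\<^sub>0 int) set \<Rightarrow> ('m' \<times> 'n \<Rightarrow>\<^sub>0 int) set" where
  "tensor_map R f M' N C =
    (\<Union>c\<in>C. tensor_kernel R M' N #>\<^bsub>free_Abelian_group (carrier M' \<times> carrier N)\<^esub>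
      frag_extend (\<lambda>(x, y). frag_of (f x, y)) c)"

text \<open>
  \<open>K\<close> is a quotient field of \<open>R\<close>, with its \<open>R\<close>-algebra structure: \<open>R\<close> embeds by \<open>r \<mapsto> r \<cdot> 1\<close> and
  each \<open>k\<close> in \<open>K\<close> is a fraction \<open>a / b\<close>, that is, \<open>b \<cdot> k = a \<cdot> 1\<close>.
\<close>

definition quotient_field :: "('r, 'x) ring_scheme \<Rightarrow> ('r, 'k) module \<Rightarrow> bool" where
  "quotient_field R K \<longleftrightarrow>
    algebra R K \<and> field K \<and> inj_on (\<lambda>r. r \<odot>\<^bsub>K\<^esub> \<one>\<^bsub>K\<^esub>) (carrier R) \<and>
    (\<forall>k\<in>carrier K. \<exists>a\<in>carrier R. \<exists>b\<in>carrier R - {\<zero>\<^bsub>R\<^esub>}. b \<odot>\<^bsub>K\<^esub> k = a \<odot>\<^bsub>K\<^esub> \<one>\<^bsub>K\<^esub>)"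

definition dominant ::
    "('r, 'x) ring_scheme \<Rightarrow> ('r, 'k) module \<Rightarrow> ('r, 'a) module \<Rightarrow> ('r, 'b) module \<Rightarrow>
      ('a \<Rightarrow> 'b) \<Rightarrow> bool" where
  "dominant R K A B f \<longleftrightarrow>
    tensor_map R f B K ` carrier (tensor_product R A K) = carrier (tensor_product R B K)"

section \<open>Properties of the restriction functor\<close>

text \<open>
  \<open>sub N L\<close> says which subsets \<open>N\<close> of the \<open>A\<close>-module \<open>L\<close> count as subobjects. The final equation says
  that restriction of scalars sends the \<open>B\<close>-submodule \<open>M'\<close> of \<open>M\<close> to the \<open>A\<close>-submodule \<open>N\<close>.
\<close>

definition image_closed_under ::
    "('m set \<Rightarrow> ('a, 'm) module \<Rightarrow> bool) \<Rightarrow> ('a \<Rightarrow> 'b) \<Rightarrow> ('b, 'x) ring_scheme \<Rightarrow>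
      ('b, 'm) module set \<Rightarrow> bool" where
  "image_closed_under sub f B C \<longleftrightarrow>
    (\<forall>M\<in>C. \<forall>N. sub N (restrict_scalars f M) \<longrightarrow>
      (\<exists>M'. submodule M' B M \<and>
        restrict_scalars f (M\<lparr>carrier := M'\<rparr>) = (restrict_scalars f M)\<lparr>carrier := N\<rparr>))"

text \<open>
  Restriction of scalars does not change the underlying maps, and morphisms are compared on the
  carrier only.
\<close>

definition full_on ::
    "('a, 'y) ring_scheme \<Rightarrow> ('b, 'x) ring_scheme \<Rightarrow> ('a \<Rightarrow> 'b) \<Rightarrow> ('b, 'm) module set \<Rightarrow> bool" where
  "full_on A B f C \<longleftrightarrow>
    (\<forall>M\<in>C. \<forall>M'\<in>C. \<forall>g\<in>module_hom A (restrict_scalars f M) (restrict_scalars f M').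
      \<exists>h\<in>module_hom B M M'. \<forall>x\<in>carrier M. h x = g x)"

end

theory Submission
  imports Defs
begin

text \<open>
  Dominance means that \<open>B / f(A)\<close> is \<open>R\<close>-torsion: every \<open>b\<close> in \<open>B\<close> has a nonzero multiple \<open>r b\<close> in
  \<open>f(A)\<close>. Given this, \<open>r b x = f(a) x\<close> shows that a saturated \<open>A\<close>-submodule is \<open>B\<close>-stable, and that
  \<open>r (g(b x) - b g(x)) = 0\<close> for \<open>A\<close>-linear \<open>g\<close>. Conversely, an \<open>A\<close>-submodule of the regular module
  \<open>B\<close> that contains \<open>1\<close> and is \<open>B\<close>-stable is all of \<open>B\<close>; apply this to the saturation of \<open>f(A)\<close> in
  the first part, and to \<open>f(A)\<close> itself in the second.
\<close>

section \<open>Tensor products\<close>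

text \<open>\<open>dominant\<close> speaks of tensor products with \<open>K\<close>, the overview of
  torsion in the cokernel; passing between the two is most of the work. Torsion gives surjectivity
  by moving a factor r across the tensor sign. The converse must bring an identity in B \<otimes> K
  back to \<open>B\<close>, although B \<otimes> K is only given by generators and relations.
  Additive maps on formal sums that multiply by a fixed denominator serve this purpose. Such a map
  respects a given relation only if its denominator is divisible enough, so the argument always
  speaks of all multiples of some nonzero s.

  A second obstacle is one of types: closure is assumed for modules with carrier in
  \<open>'m\<close>, but the module to be tested is \<open>B\<close> itself. The bound on the size
  of \<open>'m\<close> yields an injection along which \<open>B\<close> is copied, and
  torsion-freeness of \<open>B\<close> puts the copy into the class that both converses
  test.\<close>

lemma hom_free_Abelian_group_diff:
  assumes "group G" "h \<in> hom (free_Abelian_group S) G"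
    and "Poly_Mapping.keys x \<subseteq> S" "Poly_Mapping.keys y \<subseteq> S"
  shows "h (x - y) = h x \<otimes>\<^bsub>G\<^esub> inv\<^bsub>G\<^esub> (h y)"
proof -
  interpret group_hom "free_Abelian_group S" G h
    using assms by (simp add: group_hom_def group_hom_axioms_def)
  have x: "x \<in> carrier (free_Abelian_group S)" and y: "y \<in> carrier (free_Abelian_group S)"
    using assms by simp_all
  show ?thesis
    using hom_mult[OF x G.inv_closed[OF y]] unfolding hom_inv[OF y] using assms by simp
qed

lemma subgroup_free_Abelian_group_diff:
  assumes "subgroup H (free_Abelian_group S)" "x \<in> H" "y \<in> H"
  shows "x - y \<in> H"
proof -
  have "Poly_Mapping.keys y \<subseteq> S"
    using subgroup.mem_carrier[OF assms(1,3)] by simp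
  then have "- y \<in> H"
    using subgroup.m_inv_closed[OF assms(1,3)] by simp
  then show ?thesis
    using subgroup.m_closed[OF assms(1,2), of "- y"] by simp
qed

lemma subgroup_free_Abelian_groupI:
  assumes "H \<subseteq> carrier (free_Abelian_group S)" "0 \<in> H" "\<And>x y. x \<in> H \<Longrightarrow> y \<in> H \<Longrightarrow> x - y \<in> H"
  shows "subgroup H (free_Abelian_group S)"
proof -
  have uminus: "- x \<in> H" if "x \<in> H" for x
    using assms(3)[OF assms(2) that] by simp
  have "x + y \<in> H" if "x \<in> H" "y \<in> H" for x y
    using assms(3)[OF that(1) uminus[OF that(2)]] by simp
  then show ?thesis
    using assms uminus by unfold_locales auto
qed

lemma tensor_relationsI:
  "\<lbrakk>x \<in> carrier M; x' \<in> carrier M; y \<in> carrier N\<rbrakk> \<Longrightarrow>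
    frag_of (x \<oplus>\<^bsub>M\<^esub> x', y) - frag_of (x, y) - frag_of (x', y) \<in> tensor_relations R M N"
  "\<lbrakk>x \<in> carrier M; y \<in> carrier N; y' \<in> carrier N\<rbrakk> \<Longrightarrow>
    frag_of (x, y \<oplus>\<^bsub>N\<^esub> y') - frag_of (x, y) - frag_of (x, y') \<in> tensor_relations R M N"
  "\<lbrakk>r \<in> carrier R; x \<in> carrier M; y \<in> carrier N\<rbrakk> \<Longrightarrow>
    frag_of (r \<odot>\<^bsub>M\<^esub> x, y) - frag_of (x, r \<odot>\<^bsub>N\<^esub> y) \<in> tensor_relations R M N"
  unfolding tensor_relations_def by blast+

lemma tensor_relationsE [consumes 1, case_names add_left add_right smult]:
  assumes "c \<in> tensor_relations R M N"
  obtains x x' y where "x \<in> carrier M" "x' \<in> carrier M" "y \<in> carrier N"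
      "c = frag_of (x \<oplus>\<^bsub>M\<^esub> x', y) - frag_of (x, y) - frag_of (x', y)"
    | x y y' where "x \<in> carrier M" "y \<in> carrier N" "y' \<in> carrier N"
      "c = frag_of (x, y \<oplus>\<^bsub>N\<^esub> y') - frag_of (x, y) - frag_of (x, y')"
    | r x y where "r \<in> carrier R" "x \<in> carrier M" "y \<in> carrier N"
      "c = frag_of (r \<odot>\<^bsub>M\<^esub> x, y) - frag_of (x, r \<odot>\<^bsub>N\<^esub> y)"
  using assms unfolding tensor_relations_def by blast

lemma tensor_relations_subset:
  assumes "module R M" "module R N"
  shows "tensor_relations R M N \<subseteq> carrier (free_Abelian_group (carrier M \<times> carrier N))"
proof -
  interpret M: module R M by fact
  interpret N: module R N by fact
  show ?thesis
    by (auto simp: tensor_relations_def dest!: keys_diff[THEN subsetD])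
qed

lemma subgroup_tensor_kernel:
  assumes "module R M" "module R N"
  shows "subgroup (tensor_kernel R M N) (free_Abelian_group (carrier M \<times> carrier N))"
  unfolding tensor_kernel_def
  by (intro group.generate_is_subgroup tensor_relations_subset assms) simp

lemma tensor_kernel_least:
  assumes "subgroup H (free_Abelian_group (carrier M \<times> carrier N))" "tensor_relations R M N \<subseteq> H"
  shows "tensor_kernel R M N \<subseteq> H"
  unfolding tensor_kernel_def
  using assms by (intro group.generate_subgroup_incl) auto

lemma tensor_relations_subset_kernel: "tensor_relations R M N \<subseteq> tensor_kernel R M N"
  unfolding tensor_kernel_def by (auto intro: generate.incl)

lemma mem_tensor_coset_iff:
  assumes "module R M" "module R N"
    and "c \<in> carrier (free_Abelian_group (carrier M \<times> carrier N))"
    and "d \<in> carrier (free_Abelian_group (carrier M \<times> carrier N))"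
  shows "d \<in> tensor_kernel R M N #>\<^bsub>free_Abelian_group (carrier M \<times> carrier N)\<^esub> c
    \<longleftrightarrow> d - c \<in> tensor_kernel R M N"
  using subgroup.rcos_module[OF subgroup_tensor_kernel[OF assms(1,2)] group_free_Abelian_group assms(3,4)]
    assms(3) by simp

lemma tensor_coset_eqI:
  assumes "module R M" "module R N"
    and "c \<in> carrier (free_Abelian_group (carrier M \<times> carrier N))"
    and "d \<in> carrier (free_Abelian_group (carrier M \<times> carrier N))"
    and "d - c \<in> tensor_kernel R M N"
  shows "tensor_kernel R M N #>\<^bsub>free_Abelian_group (carrier M \<times> carrier N)\<^esub> c
    = tensor_kernel R M N #>\<^bsub>free_Abelian_group (carrier M \<times> carrier N)\<^esub> d"
  using group.repr_independence[OF group_free_Abelian_group _ assms(3) subgroup_tensor_kernel[OF assms(1,2)]]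
    mem_tensor_coset_iff[OF assms(1-4)] assms(5) by blast

lemma carrier_tensor_product:
  "carrier (tensor_product R M N) =
    (\<lambda>c. tensor_kernel R M N #>\<^bsub>free_Abelian_group (carrier M \<times> carrier N)\<^esub> c) `
      carrier (free_Abelian_group (carrier M \<times> carrier N))"
  by (auto simp: tensor_product_def FactGroup_def RCOSETS_def)

section \<open>The map induced on the first tensor factor, lifted to formal sums\<close>

abbreviation frag_tensor :: "('m \<Rightarrow> 'm') \<Rightarrow> ('m \<times> 'n \<Rightarrow>\<^sub>0 int) \<Rightarrow> ('m' \<times> 'n \<Rightarrow>\<^sub>0 int)" where
  "frag_tensor f \<equiv> frag_extend (\<lambda>(x, y). frag_of (f x, y))"

lemma frag_tensor_closed:
  assumes "f \<in> carrier M \<rightarrow> carrier M'" "c \<in> carrier (free_Abelian_group (carrier M \<times> carrier N))"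
  shows "frag_tensor f c \<in> carrier (free_Abelian_group (carrier M' \<times> carrier N))"
  using assms keys_frag_extend[of "\<lambda>(x, y). frag_of (f x, y)" c] by fastforce

lemma module_hom_closed:
  "f \<in> module_hom R M M' \<Longrightarrow> f \<in> carrier M \<rightarrow> carrier M'"
  by (auto simp: module_hom_def hom_def)

lemma module_hom_add:
  "f \<in> module_hom R M M' \<Longrightarrow> x \<in> carrier M \<Longrightarrow> y \<in> carrier M \<Longrightarrow> f (x \<oplus>\<^bsub>M\<^esub> y) = f x \<oplus>\<^bsub>M'\<^esub> f y"
  by (auto simp: module_hom_def hom_def)

lemma module_hom_smult:
  "f \<in> module_hom R M M' \<Longrightarrow> r \<in> carrier R \<Longrightarrow> x \<in> carrier M \<Longrightarrow> f (r \<odot>\<^bsub>M\<^esub> x) = r \<odot>\<^bsub>M'\<^esub> f x"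
  by (auto simp: module_hom_def)

text \<open>The formal sums that are sent into the target kernel form a subgroup, and linearity of
  \<open>f\<close> turns each generating relation into one of the same kind.\<close>

lemma frag_tensor_kernel:
  assumes "module R M" "module R M'" "module R N" "f \<in> module_hom R M M'"
    and "c \<in> tensor_kernel R M N"
  shows "frag_tensor f c \<in> tensor_kernel R M' N"
proof -
  note f = module_hom_closed[OF assms(4)] module_hom_add[OF assms(4)] module_hom_smult[OF assms(4)]
  let ?H = "{c \<in> carrier (free_Abelian_group (carrier M \<times> carrier N)). frag_tensor f c \<in> tensor_kernel R M' N}"
  have sub: "subgroup (tensor_kernel R M' N) (free_Abelian_group (carrier M' \<times> carrier N))"
    using assms by (intro subgroup_tensor_kernel)
  have "subgroup ?H (free_Abelian_group (carrier M \<times> carrier N))"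
  proof (rule subgroup_free_Abelian_groupI)
    show "0 \<in> ?H"
      using subgroup.one_closed[OF sub] by simp
    show "x - y \<in> ?H" if "x \<in> ?H" "y \<in> ?H" for x y
      using that keys_diff[of x y] subgroup_free_Abelian_group_diff[OF sub]
      by (auto simp: frag_extend_diff)
  qed auto
  moreover have "tensor_relations R M N \<subseteq> ?H"
  proof
    fix c assume c: "c \<in> tensor_relations R M N"
    then have "frag_tensor f c \<in> tensor_relations R M' N"
      using c f by (cases rule: tensor_relationsE) (auto simp: frag_extend_diff intro!: tensor_relationsI)
    then show "c \<in> ?H"
      using c tensor_relations_subset[OF assms(1,3)] tensor_relations_subset_kernel[of R M' N] by blast
  qed
  ultimately have "tensor_kernel R M N \<subseteq> ?H"
    by (rule tensor_kernel_least)
  then show ?thesis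
    using assms(5) by blast
qed

text \<open>Two members of a coset differ by an element of the kernel, and
  \<open>frag_tensor f\<close> preserves kernels. All cosets in the union that defines
  \<open>tensor_map\<close> therefore coincide.\<close>

lemma tensor_map_coset:
  assumes "module R M" "module R M'" "module R N" "f \<in> module_hom R M M'"
    and c: "c \<in> carrier (free_Abelian_group (carrier M \<times> carrier N))"
  shows "tensor_map R f M' N (tensor_kernel R M N #>\<^bsub>free_Abelian_group (carrier M \<times> carrier N)\<^esub> c)
    = tensor_kernel R M' N #>\<^bsub>free_Abelian_group (carrier M' \<times> carrier N)\<^esub> frag_tensor f c"
    (is "tensor_map _ _ _ _ ?C = _")
proof -
  have ker: "subgroup (tensor_kernel R M N) (free_Abelian_group (carrier M \<times> carrier N))"
    using assms by (intro subgroup_tensor_kernel)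
  have eq: "tensor_kernel R M' N #>\<^bsub>free_Abelian_group (carrier M' \<times> carrier N)\<^esub> frag_tensor f d
      = tensor_kernel R M' N #>\<^bsub>free_Abelian_group (carrier M' \<times> carrier N)\<^esub> frag_tensor f c"
    if d: "d \<in> ?C" for d
  proof -
    have d': "d \<in> carrier (free_Abelian_group (carrier M \<times> carrier N))"
      using subgroup.elemrcos_carrier[OF ker group_free_Abelian_group c d] .
    have "frag_tensor f (d - c) \<in> tensor_kernel R M' N"
      using mem_tensor_coset_iff[OF assms(1,3) c d'] d assms(1-4)
      by (intro frag_tensor_kernel[of R M]) auto
    then show ?thesis
      using frag_tensor_closed[OF module_hom_closed[OF assms(4)]] c d' assms(2,3)
      by (intro tensor_coset_eqI[symmetric]) (auto simp: frag_extend_diff simp del: carrier_free_Abelian_group_iff)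
  qed
  moreover have "c \<in> ?C"
    using group.rcos_self[OF group_free_Abelian_group c ker] .
  ultimately show ?thesis
    unfolding tensor_map_def by blast
qed

text \<open>Removes cosets from the later arguments: surjectivity becomes a congruence of formal
  sums modulo the kernel.\<close>

lemma tensor_map_surj_iff:
  assumes "module R M" "module R M'" "module R N" "f \<in> module_hom R M M'"
  shows "tensor_map R f M' N ` carrier (tensor_product R M N) = carrier (tensor_product R M' N) \<longleftrightarrow>
    (\<forall>d\<in>carrier (free_Abelian_group (carrier M' \<times> carrier N)).
      \<exists>c\<in>carrier (free_Abelian_group (carrier M \<times> carrier N)).
        d - frag_tensor f c \<in> tensor_kernel R M' N)"
    (is "?L = (\<forall>d\<in>?D. \<exists>c\<in>?C. _)")
proof -
  let ?q = "\<lambda>c. tensor_kernel R M' N #>\<^bsub>free_Abelian_group (carrier M' \<times> carrier N)\<^esub> c"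
  have closed: "frag_tensor f c \<in> ?D" if "c \<in> ?C" for c
    using frag_tensor_closed[OF module_hom_closed[OF assms(4)] that] .
  have image: "tensor_map R f M' N ` carrier (tensor_product R M N) = (\<lambda>c. ?q (frag_tensor f c)) ` ?C"
    unfolding carrier_tensor_product image_image
    by (intro image_cong refl tensor_map_coset assms)
  have "?q (frag_tensor f c) = ?q d \<longleftrightarrow> d - frag_tensor f c \<in> tensor_kernel R M' N"
    if "c \<in> ?C" "d \<in> ?D" for c d
    using tensor_coset_eqI[OF assms(2,3) closed[OF that(1)] that(2)]
      mem_tensor_coset_iff[OF assms(2,3) closed[OF that(1)] that(2)]
      group.rcos_self[OF group_free_Abelian_group that(2) subgroup_tensor_kernel[OF assms(2,3)]]
    by auto
  moreover have "?L \<longleftrightarrow> (\<forall>d\<in>?D. \<exists>c\<in>?C. ?q (frag_tensor f c) = ?q d)"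
  proof -
    \<comment> \<open>By \<open>closed\<close> the image consists of cosets of the target, so only
      one inclusion is at stake.\<close>
    have "?L \<longleftrightarrow> ?q ` ?D \<subseteq> (\<lambda>c. ?q (frag_tensor f c)) ` ?C"
      unfolding image unfolding carrier_tensor_product using closed by blast
    then show ?thesis
      by (simp add: image_subset_iff image_iff eq_commute del: carrier_free_Abelian_group_iff)
  qed
  ultimately show ?thesis
    by auto
qed

section \<open>Dominance as torsion of the cokernel\<close>

text \<open>Torsion of M'/f(M), spelled out on representatives so that neither the quotient module
  nor \<open>K\<close> enters.\<close>

definition torsion_cokernel ::
    "('r, 'x) ring_scheme \<Rightarrow> ('r, 'a) module \<Rightarrow> ('r, 'b) module \<Rightarrow> ('a \<Rightarrow> 'b) \<Rightarrow> bool" where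
  "torsion_cokernel R M M' f \<longleftrightarrow>
    (\<forall>x\<in>carrier M'. \<exists>r\<in>carrier R - {\<zero>\<^bsub>R\<^esub>}. r \<odot>\<^bsub>M'\<^esub> x \<in> f ` carrier M)"

lemma additive_subgroup_module_hom_image:
  assumes "abelian_group M" "abelian_group M'" "f \<in> module_hom R M M'"
  shows "additive_subgroup (f ` carrier M) M'"
proof -
  interpret group_hom "add_monoid M" "add_monoid M'" f
    using assms by (auto simp: group_hom_def group_hom_axioms_def module_hom_def abelian_group.a_group)
  show ?thesis
    using img_is_subgroup by (simp add: additive_subgroup_def)
qed

text \<open>The two additivity relations are a sum minus both of its terms; this is why their images
  vanish.\<close>

lemma (in abelian_group) add_minus_cancel:
  "x \<in> carrier G \<Longrightarrow> y \<in> carrier G \<Longrightarrow> x \<oplus> y \<ominus> x \<ominus> y = \<zero>"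
  by (metis a_comm a_minus_def add.inv_closed add.inv_solve_right' a_closed r_neg)

text \<open>
  These maps replace the localization of \<open>M\<close>: \<open>h t\<close> sends \<open>x \<otimes> k\<close> to \<open>(t k) x\<close> whenever \<open>t\<close> is a denominator
  of \<open>k\<close>, and kills any given tensor relation once \<open>t\<close> is divisible enough.
\<close>

lemma clear_denominators:
  assumes "quotient_field R K" "module R M"
  obtains h where "\<And>t. h t \<in> hom (free_Abelian_group (carrier M \<times> carrier K)) (add_monoid M)"
    and "\<And>t x k a. \<lbrakk>x \<in> carrier M; k \<in> carrier K; a \<in> carrier R; t \<odot>\<^bsub>K\<^esub> k = a \<odot>\<^bsub>K\<^esub> \<one>\<^bsub>K\<^esub>\<rbrakk> \<Longrightarrow>
      h t (frag_of (x, k)) = a \<odot>\<^bsub>M\<^esub> x"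
proof -
  interpret M: module R M by fact
  define i where "i r = r \<odot>\<^bsub>K\<^esub> \<one>\<^bsub>K\<^esub>" for r
  have inj: "inj_on i (carrier R)"
    using assms(1) unfolding quotient_field_def i_def by blast
  \<comment> \<open>The numerator of t k is unique because \<open>i\<close> is injective. Where
    \<open>t\<close> is no denominator of \<open>k\<close>, the value zero merely makes the map
    total; by freeness any choice of values on pairs extends additively.\<close>
  define g where "g t = (\<lambda>(x, k). if t \<odot>\<^bsub>K\<^esub> k \<in> i ` carrier R
    then inv_into (carrier R) i (t \<odot>\<^bsub>K\<^esub> k) \<odot>\<^bsub>M\<^esub> x else \<zero>\<^bsub>M\<^esub>)" for t
  have "\<exists>h\<in>hom (free_Abelian_group (carrier M \<times> carrier K)) (add_monoid M).
      \<forall>z\<in>carrier M \<times> carrier K. h (frag_of z) = g t z" for t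
  proof -
    have "g t ` (carrier M \<times> carrier K) \<subseteq> carrier (add_monoid M)"
      by (auto simp: g_def intro!: M.smult_closed inv_into_into)
    then show ?thesis
      by (rule comm_group.free_Abelian_group_universal[OF M.a_comm_group]) blast
  qed
  then obtain h where h: "\<And>t. h t \<in> hom (free_Abelian_group (carrier M \<times> carrier K)) (add_monoid M)"
      "\<And>t z. z \<in> carrier M \<times> carrier K \<Longrightarrow> h t (frag_of z) = g t z"
    by metis
  have "h t (frag_of (x, k)) = a \<odot>\<^bsub>M\<^esub> x"
    if "x \<in> carrier M" "k \<in> carrier K" "a \<in> carrier R" "t \<odot>\<^bsub>K\<^esub> k = a \<odot>\<^bsub>K\<^esub> \<one>\<^bsub>K\<^esub>" for t x k a
  proof -
    have "t \<odot>\<^bsub>K\<^esub> k = i a"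
      using that by (simp add: i_def)
    then show ?thesis
      using that inj h(2)[of "(x, k)"] by (simp add: g_def)
  qed
  with h(1) show ?thesis
    using that by blast
qed

text \<open>Let \<open>H\<close> consist of the formal sums that some nonzero \<open>s\<close>,
  together with all its multiples, clears into f(M). Relations clear to zero and lifted images clear
  into f(M), so \<open>H\<close> contains the tensor kernel and the image of
  \<open>frag_tensor f\<close>. By surjectivity it then contains the generator (b, 1), and clearing
  this one gives s b \<in> f(M).\<close>

lemma torsion_cokernel_if_tensor_map_surj:
  assumes "domain R" "quotient_field R K" "module R M" "module R M'" "f \<in> module_hom R M M'"
    and surj: "tensor_map R f M' K ` carrier (tensor_product R M K) = carrier (tensor_product R M' K)"
  shows "torsion_cokernel R M M' f"
  unfolding torsion_cokernel_def
proof
  fix b assume b: "b \<in> carrier M'"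
  interpret R: domain R by fact
  interpret M: module R M by fact
  interpret M': module R M' by fact
  interpret K: algebra R K using assms(2) by (simp add: quotient_field_def)
  note f = module_hom_closed[OF assms(5)] module_hom_smult[OF assms(5)]
  obtain h where h: "\<And>t. h t \<in> hom (free_Abelian_group (carrier M' \<times> carrier K)) (add_monoid M')"
    and h_of: "\<And>t x k a. \<lbrakk>x \<in> carrier M'; k \<in> carrier K; a \<in> carrier R; t \<odot>\<^bsub>K\<^esub> k = a \<odot>\<^bsub>K\<^esub> \<one>\<^bsub>K\<^esub>\<rbrakk> \<Longrightarrow>
      h t (frag_of (x, k)) = a \<odot>\<^bsub>M'\<^esub> x"
    using clear_denominators[OF assms(2,4)] by metis
  let ?G = "free_Abelian_group (carrier M' \<times> carrier K)"
  interpret F: additive_subgroup "f ` carrier M" M'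
    using assms by (intro additive_subgroup_module_hom_image) unfold_locales
  have h_diff: "h t (x - y) = h t x \<ominus>\<^bsub>M'\<^esub> h t y" if "x \<in> carrier ?G" "y \<in> carrier ?G" for t x y
    using hom_free_Abelian_group_diff[OF M'.a_group h[of t], of x y] that by (simp add: a_inv_def a_minus_def)
  have h_diff3: "h t (frag_of z - frag_of z' - frag_of z'')
      = h t (frag_of z) \<ominus>\<^bsub>M'\<^esub> h t (frag_of z') \<ominus>\<^bsub>M'\<^esub> h t (frag_of z'')"
    if "{z, z', z''} \<subseteq> carrier M' \<times> carrier K" for t z z' z''
  proof -
    have "frag_of z - frag_of z' \<in> carrier ?G"
      using that keys_diff[of "frag_of z" "frag_of z'"] by auto
    then show ?thesis
      using that by (simp add: h_diff del: carrier_free_Abelian_group_iff)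
  qed
  have h_0: "h t 0 = \<zero>\<^bsub>M'\<^esub>" for t
    using h_diff[of 0 0 t] hom_in_carrier[OF h, of 0 t] by (simp add: M'.minus_eq M'.r_neg)
  have denominator: "\<exists>s\<in>carrier R - {\<zero>\<^bsub>R\<^esub>}. \<exists>a\<in>carrier R. s \<odot>\<^bsub>K\<^esub> k = a \<odot>\<^bsub>K\<^esub> \<one>\<^bsub>K\<^esub>" if "k \<in> carrier K" for k
    using assms(2) that unfolding quotient_field_def by blast
  \<comment> \<open>Asking this of \<open>s\<close> alone would not do: \<open>h s\<close> may be
    zero on a pair merely because \<open>s\<close> is no denominator, while a multiple of
    \<open>s\<close> is one. The condition on all multiples passes from \<open>s\<close> to its
    multiples, so two sums can share an \<open>s\<close>.\<close>
  define P where "P s c \<longleftrightarrow> (\<forall>t\<in>carrier R. h (t \<otimes>\<^bsub>R\<^esub> s) c \<in> f ` carrier M)" for s c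
  have PI: "(\<And>t. t \<in> carrier R \<Longrightarrow> h (t \<otimes>\<^bsub>R\<^esub> s) c \<in> f ` carrier M) \<Longrightarrow> P s c"
    and PD: "P s c \<Longrightarrow> t \<in> carrier R \<Longrightarrow> h (t \<otimes>\<^bsub>R\<^esub> s) c \<in> f ` carrier M" for s c t
    by (simp_all add: P_def)
  define H where "H = {c \<in> carrier ?G. \<exists>s\<in>carrier R - {\<zero>\<^bsub>R\<^esub>}. P s c}"
  have H: "subgroup H ?G"
  proof (rule subgroup_free_Abelian_groupI)
    show "0 \<in> H"
      using F.zero_closed PI[of "\<one>\<^bsub>R\<^esub>" 0] R.one_not_zero unfolding H_def h_0 by auto
    show "x - y \<in> H" if xH: "x \<in> H" and yH: "y \<in> H" for x y
    proof -
      obtain s where s: "s \<in> carrier R - {\<zero>\<^bsub>R\<^esub>}" "P s x"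
        using xH unfolding H_def by blast
      obtain s' where s': "s' \<in> carrier R - {\<zero>\<^bsub>R\<^esub>}" "P s' y"
        using yH unfolding H_def by blast
      have xy: "x \<in> carrier ?G" "y \<in> carrier ?G"
        using xH yH by (simp_all add: H_def)
      have "h (t \<otimes>\<^bsub>R\<^esub> (s \<otimes>\<^bsub>R\<^esub> s')) (x - y) \<in> f ` carrier M" if t: "t \<in> carrier R" for t
      proof -
        \<comment> \<open>A multiple of s s' is a multiple of \<open>s\<close> and of
          \<open>s'\<close>, so both conditions apply to it.\<close>
        have "t \<otimes>\<^bsub>R\<^esub> (s \<otimes>\<^bsub>R\<^esub> s') = (t \<otimes>\<^bsub>R\<^esub> s') \<otimes>\<^bsub>R\<^esub> s" "t \<otimes>\<^bsub>R\<^esub> (s \<otimes>\<^bsub>R\<^esub> s') = (t \<otimes>\<^bsub>R\<^esub> s) \<otimes>\<^bsub>R\<^esub> s'"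
          using t s s' by (simp_all add: R.m_ac)
        then have "h (t \<otimes>\<^bsub>R\<^esub> (s \<otimes>\<^bsub>R\<^esub> s')) x \<in> f ` carrier M" "h (t \<otimes>\<^bsub>R\<^esub> (s \<otimes>\<^bsub>R\<^esub> s')) y \<in> f ` carrier M"
          using PD[OF s(2), of "t \<otimes>\<^bsub>R\<^esub> s'"] PD[OF s'(2), of "t \<otimes>\<^bsub>R\<^esub> s"] t s(1) s'(1) by auto
        then show ?thesis
          unfolding h_diff[OF xy] a_minus_def by (intro F.a_closed F.a_inv_closed)
      qed
      then have "P (s \<otimes>\<^bsub>R\<^esub> s') (x - y)"
        by (rule PI)
      moreover have "s \<otimes>\<^bsub>R\<^esub> s' \<in> carrier R - {\<zero>\<^bsub>R\<^esub>}"
        using s s' R.integral by auto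
      moreover have "x - y \<in> carrier ?G"
        using xy keys_diff[of x y] by auto
      ultimately show ?thesis
        unfolding H_def by blast
    qed
  qed (auto simp: H_def)
  have rel: "tensor_relations R M' K \<subseteq> H"
  proof
    fix c assume c: "c \<in> tensor_relations R M' K"
    \<comment> \<open>Once s is a denominator of every element of \<open>K\<close> that occurs in
      the relation, the maps for its multiples take the values of an honest bilinear expression, and
      the relation cancels.\<close>
    from c have "\<exists>s\<in>carrier R - {\<zero>\<^bsub>R\<^esub>}. \<forall>t\<in>carrier R. h (t \<otimes>\<^bsub>R\<^esub> s) c = \<zero>\<^bsub>M'\<^esub>"
    proof (cases rule: tensor_relationsE)
      case (add_left x x' y)
      obtain s a where s: "s \<in> carrier R - {\<zero>\<^bsub>R\<^esub>}" "a \<in> carrier R" "s \<odot>\<^bsub>K\<^esub> y = a \<odot>\<^bsub>K\<^esub> \<one>\<^bsub>K\<^esub>"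
        using denominator add_left by blast
      have "h (t \<otimes>\<^bsub>R\<^esub> s) (frag_of (z, y)) = (t \<otimes>\<^bsub>R\<^esub> a) \<odot>\<^bsub>M'\<^esub> z" if "t \<in> carrier R" "z \<in> carrier M'" for t z
        using that s add_left by (intro h_of) (simp_all add: K.smult_assoc1)
      then have "\<forall>t\<in>carrier R. h (t \<otimes>\<^bsub>R\<^esub> s) c = \<zero>\<^bsub>M'\<^esub>"
        using add_left s by (auto simp: h_diff3 M'.smult_r_distr M'.add_minus_cancel)
      with s show ?thesis by blast
    next
      case (add_right x y y')
      obtain s a where s: "s \<in> carrier R - {\<zero>\<^bsub>R\<^esub>}" "a \<in> carrier R" "s \<odot>\<^bsub>K\<^esub> y = a \<odot>\<^bsub>K\<^esub> \<one>\<^bsub>K\<^esub>"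
        using denominator add_right by blast
      obtain s' a' where s': "s' \<in> carrier R - {\<zero>\<^bsub>R\<^esub>}" "a' \<in> carrier R" "s' \<odot>\<^bsub>K\<^esub> y' = a' \<odot>\<^bsub>K\<^esub> \<one>\<^bsub>K\<^esub>"
        using denominator add_right by blast
      have "h (t \<otimes>\<^bsub>R\<^esub> (s \<otimes>\<^bsub>R\<^esub> s')) c = \<zero>\<^bsub>M'\<^esub>" if t: "t \<in> carrier R" for t
      proof -
        \<comment> \<open>A common denominator of \<open>y\<close> and \<open>y'\<close>. Its two
          factorizations below give the numerators, and their sum is the numerator of y +
          y'.\<close>
        define u where "u = t \<otimes>\<^bsub>R\<^esub> (s \<otimes>\<^bsub>R\<^esub> s')"
        have "u = (t \<otimes>\<^bsub>R\<^esub> s') \<otimes>\<^bsub>R\<^esub> s"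
          using t s s' by (simp add: u_def R.m_ac)
        then have u: "u \<in> carrier R" "u \<odot>\<^bsub>K\<^esub> y = (t \<otimes>\<^bsub>R\<^esub> s' \<otimes>\<^bsub>R\<^esub> a) \<odot>\<^bsub>K\<^esub> \<one>\<^bsub>K\<^esub>"
          using t s s' add_right by (simp_all add: K.smult_assoc1)
        have "u = (t \<otimes>\<^bsub>R\<^esub> s) \<otimes>\<^bsub>R\<^esub> s'"
          using t s s' by (simp add: u_def R.m_ac)
        then have u': "u \<odot>\<^bsub>K\<^esub> y' = (t \<otimes>\<^bsub>R\<^esub> s \<otimes>\<^bsub>R\<^esub> a') \<odot>\<^bsub>K\<^esub> \<one>\<^bsub>K\<^esub>"
          using t s s' add_right by (simp add: K.smult_assoc1)
        have "u \<odot>\<^bsub>K\<^esub> (y \<oplus>\<^bsub>K\<^esub> y') = (t \<otimes>\<^bsub>R\<^esub> s' \<otimes>\<^bsub>R\<^esub> a \<oplus>\<^bsub>R\<^esub> t \<otimes>\<^bsub>R\<^esub> s \<otimes>\<^bsub>R\<^esub> a') \<odot>\<^bsub>K\<^esub> \<one>\<^bsub>K\<^esub>"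
          using t s s' u u' add_right by (simp add: K.smult_r_distr K.smult_l_distr)
        then have "h u (frag_of (x, y)) = (t \<otimes>\<^bsub>R\<^esub> s' \<otimes>\<^bsub>R\<^esub> a) \<odot>\<^bsub>M'\<^esub> x"
            "h u (frag_of (x, y')) = (t \<otimes>\<^bsub>R\<^esub> s \<otimes>\<^bsub>R\<^esub> a') \<odot>\<^bsub>M'\<^esub> x"
            "h u (frag_of (x, y \<oplus>\<^bsub>K\<^esub> y')) = (t \<otimes>\<^bsub>R\<^esub> s' \<otimes>\<^bsub>R\<^esub> a \<oplus>\<^bsub>R\<^esub> t \<otimes>\<^bsub>R\<^esub> s \<otimes>\<^bsub>R\<^esub> a') \<odot>\<^bsub>M'\<^esub> x"
          using t s s' u u' add_right by (auto intro!: h_of)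
        then have "h u c = \<zero>\<^bsub>M'\<^esub>"
          using t s s' add_right by (auto simp: h_diff3 M'.smult_l_distr M'.add_minus_cancel)
        then show ?thesis
          by (simp add: u_def)
      qed
      moreover have "s \<otimes>\<^bsub>R\<^esub> s' \<in> carrier R - {\<zero>\<^bsub>R\<^esub>}"
        using s s' R.integral by auto
      ultimately show ?thesis by blast
    next
      case (smult r x y)
      obtain s a where s: "s \<in> carrier R - {\<zero>\<^bsub>R\<^esub>}" "a \<in> carrier R" "s \<odot>\<^bsub>K\<^esub> y = a \<odot>\<^bsub>K\<^esub> \<one>\<^bsub>K\<^esub>"
        using denominator smult by blast
      have "h (t \<otimes>\<^bsub>R\<^esub> s) c = \<zero>\<^bsub>M'\<^esub>" if t: "t \<in> carrier R" for t
      proof -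
        \<comment> \<open>A denominator of \<open>y\<close> is also one of r y, with the numerator
          multiplied by \<open>r\<close>.\<close>
        have ts: "(t \<otimes>\<^bsub>R\<^esub> s) \<odot>\<^bsub>K\<^esub> y = (t \<otimes>\<^bsub>R\<^esub> a) \<odot>\<^bsub>K\<^esub> \<one>\<^bsub>K\<^esub>"
          using t s smult by (simp add: K.smult_assoc1)
        have "(t \<otimes>\<^bsub>R\<^esub> s) \<odot>\<^bsub>K\<^esub> (r \<odot>\<^bsub>K\<^esub> y) = r \<odot>\<^bsub>K\<^esub> ((t \<otimes>\<^bsub>R\<^esub> s) \<odot>\<^bsub>K\<^esub> y)"
          using t s smult by (simp add: K.smult_assoc1[symmetric] R.m_ac)
        also have "\<dots> = (r \<otimes>\<^bsub>R\<^esub> (t \<otimes>\<^bsub>R\<^esub> a)) \<odot>\<^bsub>K\<^esub> \<one>\<^bsub>K\<^esub>"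
          unfolding ts using t s smult by (simp add: K.smult_assoc1)
        finally have "h (t \<otimes>\<^bsub>R\<^esub> s) (frag_of (x, r \<odot>\<^bsub>K\<^esub> y)) = (r \<otimes>\<^bsub>R\<^esub> (t \<otimes>\<^bsub>R\<^esub> a)) \<odot>\<^bsub>M'\<^esub> x"
          using t s smult by (intro h_of) auto
        moreover have "h (t \<otimes>\<^bsub>R\<^esub> s) (frag_of (r \<odot>\<^bsub>M'\<^esub> x, y)) = (t \<otimes>\<^bsub>R\<^esub> a) \<odot>\<^bsub>M'\<^esub> (r \<odot>\<^bsub>M'\<^esub> x)"
          using t s smult ts by (intro h_of) auto
        moreover have "r \<otimes>\<^bsub>R\<^esub> (t \<otimes>\<^bsub>R\<^esub> a) = (t \<otimes>\<^bsub>R\<^esub> a) \<otimes>\<^bsub>R\<^esub> r"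
          using t s smult by (simp add: R.m_ac)
        ultimately show ?thesis
          using t s smult by (simp add: h_diff M'.smult_assoc1 M'.minus_eq M'.r_neg)
      qed
      with s show ?thesis by blast
    qed
    then obtain s where s: "s \<in> carrier R - {\<zero>\<^bsub>R\<^esub>}" "\<forall>t\<in>carrier R. h (t \<otimes>\<^bsub>R\<^esub> s) c = \<zero>\<^bsub>M'\<^esub>"
      by blast
    then have "P s c"
      using F.zero_closed by (intro PI) simp
    then show "c \<in> H"
      using s(1) c tensor_relations_subset[OF assms(4) K.module] unfolding H_def by blast
  qed
  \<comment> \<open>On a generator (f a, k) with s k = q, clearing by t s gives t q f(a) = f(t q a),
    which lies in f(M).\<close>
  have image: "frag_tensor f c \<in> H" if "c \<in> carrier (free_Abelian_group (carrier M \<times> carrier K))" for c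
    using that unfolding carrier_free_Abelian_group_iff
  proof (rule free_Abelian_group_induct)
    show "frag_tensor f 0 \<in> H"
      using subgroup.one_closed[OF H] by simp
    show "frag_tensor f (x - y) \<in> H" if "frag_tensor f x \<in> H" "frag_tensor f y \<in> H" for x y
      using subgroup_free_Abelian_group_diff[OF H that] by (simp add: frag_extend_diff)
    fix z assume z: "z \<in> carrier M \<times> carrier K"
    then obtain a k where ak: "z = (a, k)" "a \<in> carrier M" "k \<in> carrier K"
      by auto
    obtain s q where s: "s \<in> carrier R - {\<zero>\<^bsub>R\<^esub>}" "q \<in> carrier R" "s \<odot>\<^bsub>K\<^esub> k = q \<odot>\<^bsub>K\<^esub> \<one>\<^bsub>K\<^esub>"
      using denominator ak by blast
    have "h (t \<otimes>\<^bsub>R\<^esub> s) (frag_of (f a, k)) = f ((t \<otimes>\<^bsub>R\<^esub> q) \<odot>\<^bsub>M\<^esub> a)" if "t \<in> carrier R" for t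
    proof -
      have "h (t \<otimes>\<^bsub>R\<^esub> s) (frag_of (f a, k)) = (t \<otimes>\<^bsub>R\<^esub> q) \<odot>\<^bsub>M'\<^esub> f a"
        using that s ak f(1) by (intro h_of) (auto simp: K.smult_assoc1)
      then show ?thesis
        using that s ak f by simp
    qed
    then have "P s (frag_of (f a, k))"
      using s ak by (intro PI) simp
    then show "frag_tensor f (frag_of z) \<in> H"
      unfolding H_def using s ak f(1) by auto
  qed
  have "frag_of (b, \<one>\<^bsub>K\<^esub>) \<in> carrier ?G"
    using b by simp
  then obtain c where c: "c \<in> carrier (free_Abelian_group (carrier M \<times> carrier K))"
      "frag_of (b, \<one>\<^bsub>K\<^esub>) - frag_tensor f c \<in> tensor_kernel R M' K"
    using surj unfolding tensor_map_surj_iff[OF assms(3,4) K.module assms(5)] by blast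
  have "frag_of (b, \<one>\<^bsub>K\<^esub>) - frag_tensor f c \<in> H"
    using c(2) tensor_kernel_least[OF H rel] by blast
  then have "frag_of (b, \<one>\<^bsub>K\<^esub>) \<in> H"
    using subgroup.m_closed[OF H _ image[OF c(1)]] by fastforce
  then obtain s where s: "s \<in> carrier R - {\<zero>\<^bsub>R\<^esub>}" "P s (frag_of (b, \<one>\<^bsub>K\<^esub>))"
    unfolding H_def by blast
  \<comment> \<open>The element 1 of \<open>K\<close> has every \<open>s\<close> as a denominator,
    and the numerator is \<open>s\<close> itself.\<close>
  have "h (\<one>\<^bsub>R\<^esub> \<otimes>\<^bsub>R\<^esub> s) (frag_of (b, \<one>\<^bsub>K\<^esub>)) = s \<odot>\<^bsub>M'\<^esub> b"
    using s b by (intro h_of) auto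
  then have "s \<odot>\<^bsub>M'\<^esub> b \<in> f ` carrier M"
    using PD[OF s(2) R.one_closed] by simp
  with s(1) show "\<exists>r\<in>carrier R - {\<zero>\<^bsub>R\<^esub>}. r \<odot>\<^bsub>M'\<^esub> b \<in> f ` carrier M"
    by blast
qed

text \<open>Injectivity of R \<rightarrow> K keeps r 1 different from 0, so it is a unit, and
  \<open>l\<close> is its inverse times \<open>k\<close>.\<close>

lemma quotient_field_divide:
  assumes "quotient_field R K" "r \<in> carrier R - {\<zero>\<^bsub>R\<^esub>}" "k \<in> carrier K"
  shows "\<exists>l\<in>carrier K. r \<odot>\<^bsub>K\<^esub> l = k"
proof -
  interpret F: field K using assms(1) by (simp add: quotient_field_def)
  interpret K: algebra R K using assms(1) by (simp add: quotient_field_def)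
  have inj: "inj_on (\<lambda>r. r \<odot>\<^bsub>K\<^esub> \<one>\<^bsub>K\<^esub>) (carrier R)"
    using assms(1) by (simp add: quotient_field_def)
  have "r \<odot>\<^bsub>K\<^esub> \<one>\<^bsub>K\<^esub> \<noteq> \<zero>\<^bsub>R\<^esub> \<odot>\<^bsub>K\<^esub> \<one>\<^bsub>K\<^esub>"
    using inj_onD[OF inj, of r "\<zero>\<^bsub>R\<^esub>"] assms(2) by auto
  then have unit: "r \<odot>\<^bsub>K\<^esub> \<one>\<^bsub>K\<^esub> \<in> Units K"
    using assms(2) by (auto simp: F.field_Units)
  let ?l = "inv\<^bsub>K\<^esub> (r \<odot>\<^bsub>K\<^esub> \<one>\<^bsub>K\<^esub>) \<otimes>\<^bsub>K\<^esub> k"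
  have l: "?l \<in> carrier K"
    using unit assms(3) by (intro F.m_closed F.Units_inv_closed)
  have "r \<odot>\<^bsub>K\<^esub> ?l = (r \<odot>\<^bsub>K\<^esub> \<one>\<^bsub>K\<^esub>) \<otimes>\<^bsub>K\<^esub> ?l"
    using assms l by (subst K.smult_assoc2) (auto simp del: F.m_assoc)
  also have "\<dots> = k"
    using unit assms by (simp add: F.m_assoc[symmetric] del: F.m_assoc)
  finally show ?thesis
    using l by blast
qed

text \<open>If r b = f(a) and r l = k, then b \<otimes> k = b \<otimes> r l = r b \<otimes> l = f(a)
  \<otimes> l. Pairs generate the formal sums, and the property is stable under differences.\<close>

lemma tensor_map_surj_if_torsion_cokernel:
  assumes "quotient_field R K" "module R M" "module R M'" "f \<in> module_hom R M M'"
    and "torsion_cokernel R M M' f"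
  shows "tensor_map R f M' K ` carrier (tensor_product R M K) = carrier (tensor_product R M' K)"
proof -
  interpret M: module R M by fact
  interpret M': module R M' by fact
  interpret K: algebra R K using assms(1) by (simp add: quotient_field_def)
  let ?G = "free_Abelian_group (carrier M \<times> carrier K)"
  note ker = subgroup_tensor_kernel[OF assms(3) K.module]
  have "\<exists>c\<in>carrier ?G. d - frag_tensor f c \<in> tensor_kernel R M' K"
    if "Poly_Mapping.keys d \<subseteq> carrier M' \<times> carrier K" for d
    using that
  proof (rule free_Abelian_group_induct)
    show "\<exists>c\<in>carrier ?G. 0 - frag_tensor f c \<in> tensor_kernel R M' K"
      using subgroup.one_closed[OF ker] by (auto intro!: bexI[of _ 0])
  next
    fix x y assume "\<exists>c\<in>carrier ?G. x - frag_tensor f c \<in> tensor_kernel R M' K"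
      "\<exists>c\<in>carrier ?G. y - frag_tensor f c \<in> tensor_kernel R M' K"
    then obtain c e where ce: "c \<in> carrier ?G" "x - frag_tensor f c \<in> tensor_kernel R M' K"
      "e \<in> carrier ?G" "y - frag_tensor f e \<in> tensor_kernel R M' K"
      by blast
    have "(x - y) - frag_tensor f (c - e) = (x - frag_tensor f c) - (y - frag_tensor f e)"
      by (simp add: frag_extend_diff)
    also have "\<dots> \<in> tensor_kernel R M' K"
      using subgroup_free_Abelian_group_diff[OF ker ce(2,4)] .
    finally show "\<exists>c\<in>carrier ?G. (x - y) - frag_tensor f c \<in> tensor_kernel R M' K"
      using ce(1,3) keys_diff[of c e] by (intro bexI[of _ "c - e"]) auto
  next
    fix z assume "z \<in> carrier M' \<times> carrier K"
    then obtain b k where z: "z = (b, k)" "b \<in> carrier M'" "k \<in> carrier K"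
      by auto
    obtain r a where r: "r \<in> carrier R - {\<zero>\<^bsub>R\<^esub>}" "a \<in> carrier M" "f a = r \<odot>\<^bsub>M'\<^esub> b"
      using assms(5) z unfolding torsion_cokernel_def by (metis imageE)
    obtain l where l: "l \<in> carrier K" "r \<odot>\<^bsub>K\<^esub> l = k"
      using quotient_field_divide[OF assms(1) r(1) z(3)] by blast
    \<comment> \<open>The relation that moves the scalar \<open>r\<close>, taken at the pair (b,
      l).\<close>
    have "frag_of (f a, l) - frag_of (b, k) \<in> tensor_kernel R M' K"
      using tensor_relationsI(3)[of r R b M' l K] tensor_relations_subset_kernel[of R M' K] r l z by auto
    then have "frag_of z - frag_tensor f (frag_of (a, l)) \<in> tensor_kernel R M' K"
      using subgroup_free_Abelian_group_diff[OF ker subgroup.one_closed[OF ker]] z by force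
    then show "\<exists>c\<in>carrier ?G. frag_of z - frag_tensor f c \<in> tensor_kernel R M' K"
      using r l by (intro bexI[of _ "frag_of (a, l)"]) auto
  qed
  then show ?thesis
    unfolding tensor_map_surj_iff[OF assms(2,3) K.module assms(4)] by auto
qed

lemma algebra_hom_module_hom:
  "f \<in> algebra_hom R A B \<Longrightarrow> f \<in> module_hom R A B"
  by (auto simp: algebra_hom_def module_hom_def ring_hom_def hom_def)

lemma dominant_iff_torsion_cokernel:
  assumes "domain R" "quotient_field R K" "module R A" "module R B" "f \<in> module_hom R A B"
  shows "dominant R K A B f \<longleftrightarrow> torsion_cokernel R A B f"
  unfolding dominant_def
  using torsion_cokernel_if_tensor_map_surj[OF assms] tensor_map_surj_if_torsion_cokernel[OF assms(2-5)]
  by blast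

section \<open>Restriction of scalars\<close>

lemma restrict_scalars_simps [simp]:
  "carrier (restrict_scalars f M) = carrier M"
  "\<zero>\<^bsub>restrict_scalars f M\<^esub> = \<zero>\<^bsub>M\<^esub>"
  "(\<oplus>\<^bsub>restrict_scalars f M\<^esub>) = (\<oplus>\<^bsub>M\<^esub>)"
  "a \<odot>\<^bsub>restrict_scalars f M\<^esub> x = f a \<odot>\<^bsub>M\<^esub> x"
  by (simp_all add: restrict_scalars_def)

lemma abelian_group_restrict_scalars:
  assumes "abelian_group M"
  shows "abelian_group (restrict_scalars f M)"
proof -
  interpret M: abelian_group M by fact
  show ?thesis
    by (rule abelian_groupI) (auto simp: M.a_ac intro: M.l_neg)
qed

lemma left_module_restrict_scalars:
  assumes "ring A" "f \<in> ring_hom A B" "left_module B M"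
  shows "left_module A (restrict_scalars f M)"
proof -
  interpret A: ring A by fact
  interpret M: left_module B M by fact
  have "f a \<in> carrier B" if "a \<in> carrier A" for a
    using assms(2) that by (rule ring_hom_closed)
  then show ?thesis
    using assms(2)
    by (intro left_module.intro left_module_axioms.intro assms(1) abelian_group_restrict_scalars M.abelian_group_axioms)
      (auto simp: M.smult_closed M.smult_l_distr M.smult_r_distr M.smult_assoc1 M.smult_one
        ring_hom_add ring_hom_mult ring_hom_one)
qed

lemma submodule_iff:
  "submodule N S M \<longleftrightarrow> subgroup N (add_monoid M) \<and> (\<forall>a\<in>carrier S. \<forall>x\<in>N. a \<odot>\<^bsub>M\<^esub> x \<in> N)"
  by (auto simp: submodule_def submodule_axioms_def)

lemma submodule_restrict_scalars_iff:
  "submodule N A (restrict_scalars f M) \<longleftrightarrow>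
    subgroup N (add_monoid M) \<and> (\<forall>a\<in>carrier A. \<forall>x\<in>N. f a \<odot>\<^bsub>M\<^esub> x \<in> N)"
  by (simp add: submodule_iff subgroup_def m_inv_def)

lemma module_hom_restrict_scalars_iff:
  "g \<in> module_hom A (restrict_scalars f M) (restrict_scalars f M') \<longleftrightarrow>
    g \<in> hom (add_monoid M) (add_monoid M') \<and>
    (\<forall>a\<in>carrier A. \<forall>x\<in>carrier M. g (f a \<odot>\<^bsub>M\<^esub> x) = f a \<odot>\<^bsub>M'\<^esub> g x)"
  by (simp add: module_hom_def hom_def)

lemma restrict_scalars_carrier_eq_iff:
  "restrict_scalars f (M\<lparr>carrier := M'\<rparr>) = (restrict_scalars f M)\<lparr>carrier := N\<rparr> \<longleftrightarrow> M' = N"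
  by (simp add: restrict_scalars_def)

text \<open>Restriction of scalars keeps the carrier, so the \<open>M'\<close> of the definition can
  only be \<open>N\<close>; what remains is stability of \<open>N\<close> under
  \<open>B\<close>.\<close>

lemma image_closed_under_iff:
  "image_closed_under sub f B C \<longleftrightarrow>
    (\<forall>M\<in>C. \<forall>N. sub N (restrict_scalars f M) \<longrightarrow> submodule N B M)"
  by (simp add: image_closed_under_def restrict_scalars_carrier_eq_iff)

section \<open>Quotient modules and saturated submodules\<close>

lemma (in left_module) smult_module_hom:
  assumes "a \<in> carrier S"
  shows "group_hom (add_monoid M) (add_monoid M) (\<lambda>x. a \<odot>\<^bsub>M\<^esub> x)"
  using assms M.a_group
  by (auto simp: group_hom_def group_hom_axioms_def hom_def smult_closed smult_r_distr)

lemma (in left_module) smult_minus: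
  assumes "a \<in> carrier S" "x \<in> carrier M" "y \<in> carrier M"
  shows "a \<odot>\<^bsub>M\<^esub> (x \<ominus>\<^bsub>M\<^esub> y) = a \<odot>\<^bsub>M\<^esub> x \<ominus>\<^bsub>M\<^esub> a \<odot>\<^bsub>M\<^esub> y"
  using group_hom.hom_inv[OF smult_module_hom[OF assms(1)], of y] assms
  by (simp add: a_minus_def a_inv_def[symmetric] smult_r_distr)

text \<open>Another representative of the coset is n + x with n \<in> N, and a n stays in
  \<open>N\<close>. The union in \<open>quotient_module\<close> is thus one of equal cosets.\<close>

lemma smult_quotient_module:
  assumes "left_module S M" "submodule N S M" "a \<in> carrier S" "x \<in> carrier M"
  shows "a \<odot>\<^bsub>quotient_module M N\<^esub> (N +>\<^bsub>M\<^esub> x) = N +>\<^bsub>M\<^esub> (a \<odot>\<^bsub>M\<^esub> x)"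
proof -
  interpret M: left_module S M by fact
  interpret N: additive_subgroup N M
    using assms(2) by (simp add: submodule_def additive_subgroup_def)
  have "N +>\<^bsub>M\<^esub> (a \<odot>\<^bsub>M\<^esub> y) = N +>\<^bsub>M\<^esub> (a \<odot>\<^bsub>M\<^esub> x)" if y: "y \<in> N +>\<^bsub>M\<^esub> x" for y
  proof -
    obtain n where n: "n \<in> N" "y = n \<oplus>\<^bsub>M\<^esub> x"
      using y by (auto simp: a_r_coset_def')
    then have "a \<odot>\<^bsub>M\<^esub> y = a \<odot>\<^bsub>M\<^esub> n \<oplus>\<^bsub>M\<^esub> a \<odot>\<^bsub>M\<^esub> x"
      using assms N.a_subset by (auto simp: M.smult_r_distr)
    moreover have "a \<odot>\<^bsub>M\<^esub> n \<in> N"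
      using assms n by (simp add: submodule_iff)
    ultimately have "a \<odot>\<^bsub>M\<^esub> y \<in> N +>\<^bsub>M\<^esub> (a \<odot>\<^bsub>M\<^esub> x)"
      by (auto simp: a_r_coset_def')
    then show ?thesis
      using M.a_repr_independence[OF _ M.smult_closed[OF assms(3,4)] N.a_subgroup] by simp
  qed
  then have "(\<Union>y\<in>N +>\<^bsub>M\<^esub> x. N +>\<^bsub>M\<^esub> (a \<odot>\<^bsub>M\<^esub> y)) = (\<Union>y\<in>N +>\<^bsub>M\<^esub> x. N +>\<^bsub>M\<^esub> (a \<odot>\<^bsub>M\<^esub> x))"
    by (intro SUP_cong refl)
  moreover have "x \<in> N +>\<^bsub>M\<^esub> x"
    using M.a_rcosI[OF N.zero_closed N.a_subset assms(4)] assms(4) by simp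
  ultimately show ?thesis
    by (auto simp: quotient_module_def)
qed

text \<open>A coset is the zero of the quotient exactly when its representative lies in
  \<open>N\<close>; this turns torsion-freeness of the quotient into a cancellation property of
  \<open>N\<close>.\<close>

lemma saturated_submodule_iff:
  assumes "assoc_algebra R A" "left_module A M"
  shows "saturated_submodule R N A M \<longleftrightarrow> submodule N A M \<and>
    (\<forall>r\<in>carrier R - {\<zero>\<^bsub>R\<^esub>}. \<forall>x\<in>carrier M. (r \<odot>\<^bsub>A\<^esub> \<one>\<^bsub>A\<^esub>) \<odot>\<^bsub>M\<^esub> x \<in> N \<longrightarrow> x \<in> N)"
proof (cases "submodule N A M")
  case True
  interpret A: ring A using assms(1) by (simp add: assoc_algebra_def)
  interpret RA: assoc_algebra R A by fact
  interpret M: left_module A M by fact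
  interpret N: additive_subgroup N M
    using True by (simp add: submodule_def additive_subgroup_def)
  have coset_eq: "N +>\<^bsub>M\<^esub> x = N \<longleftrightarrow> x \<in> N" if "x \<in> carrier M" for x
    using M.a_coset_join1[OF _ that N.a_subgroup] M.a_coset_join2[OF that N.a_subgroup] by blast
  have "r \<odot>\<^bsub>base_module A (quotient_module M N)\<^esub> (N +>\<^bsub>M\<^esub> x) = N +>\<^bsub>M\<^esub> ((r \<odot>\<^bsub>A\<^esub> \<one>\<^bsub>A\<^esub>) \<odot>\<^bsub>M\<^esub> x)"
    if "r \<in> carrier R" "x \<in> carrier M" for r x
    unfolding base_module_def using smult_quotient_module[OF assms(2) True _ that(2)] that by simp
  moreover have "carrier (base_module A (quotient_module M N)) = (\<lambda>x. N +>\<^bsub>M\<^esub> x) ` carrier M"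
    by (auto simp: base_module_def quotient_module_def A_RCOSETS_def')
  moreover have "\<zero>\<^bsub>base_module A (quotient_module M N)\<^esub> = N"
    by (simp add: base_module_def quotient_module_def)
  ultimately have "torsion_free R (base_module A (quotient_module M N)) \<longleftrightarrow>
    (\<forall>r\<in>carrier R. \<forall>x\<in>carrier M. (r \<odot>\<^bsub>A\<^esub> \<one>\<^bsub>A\<^esub>) \<odot>\<^bsub>M\<^esub> x \<in> N \<longrightarrow> r = \<zero>\<^bsub>R\<^esub> \<or> x \<in> N)"
    using coset_eq M.smult_closed by (simp add: torsion_free_def)
  then show ?thesis
    using True by (auto simp: saturated_submodule_def)
qed (simp add: saturated_submodule_def)

text \<open>The left regular module of \<open>B\<close>, transported along an injection \<phi> into
  the type over which the closure hypotheses range. The fields \<open>mult\<close> and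
  \<open>one\<close> carry no meaning for a module.\<close>

definition regular_copy :: "('b \<Rightarrow> 'm) \<Rightarrow> ('b, 'x) ring_scheme \<Rightarrow> ('b, 'm) module" where
  "regular_copy \<phi> B =
    \<lparr>carrier = \<phi> ` carrier B, monoid.mult = undefined, one = undefined, ring.zero = \<phi> \<zero>\<^bsub>B\<^esub>,
     ring.add = (\<lambda>x y. \<phi> (inv_into (carrier B) \<phi> x \<oplus>\<^bsub>B\<^esub> inv_into (carrier B) \<phi> y)),
     smult = (\<lambda>b x. \<phi> (b \<otimes>\<^bsub>B\<^esub> inv_into (carrier B) \<phi> x))\<rparr>"

lemma regular_copy_simps:
  assumes "inj_on \<phi> (carrier B)"
  shows "carrier (regular_copy \<phi> B) = \<phi> ` carrier B"
    and "\<zero>\<^bsub>regular_copy \<phi> B\<^esub> = \<phi> \<zero>\<^bsub>B\<^esub>"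
    and "\<lbrakk>x \<in> carrier B; y \<in> carrier B\<rbrakk> \<Longrightarrow> \<phi> x \<oplus>\<^bsub>regular_copy \<phi> B\<^esub> \<phi> y = \<phi> (x \<oplus>\<^bsub>B\<^esub> y)"
    and "x \<in> carrier B \<Longrightarrow> b \<odot>\<^bsub>regular_copy \<phi> B\<^esub> \<phi> x = \<phi> (b \<otimes>\<^bsub>B\<^esub> x)"
  using assms by (simp_all add: regular_copy_def)

lemma left_module_regular_copy:
  assumes "ring B" "inj_on \<phi> (carrier B)"
  shows "left_module B (regular_copy \<phi> B)"
proof -
  interpret B: ring B by fact
  note simps = regular_copy_simps[OF assms(2)]
  have "abelian_group (regular_copy \<phi> B)"
  proof (rule abelian_groupI)
    fix x assume "x \<in> carrier (regular_copy \<phi> B)"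
    then obtain b where b: "b \<in> carrier B" "x = \<phi> b"
      by (auto simp: simps)
    then have "\<phi> (\<ominus>\<^bsub>B\<^esub> b) \<oplus>\<^bsub>regular_copy \<phi> B\<^esub> x = \<zero>\<^bsub>regular_copy \<phi> B\<^esub>"
      by (simp add: simps B.l_neg)
    then show "\<exists>y\<in>carrier (regular_copy \<phi> B). y \<oplus>\<^bsub>regular_copy \<phi> B\<^esub> x = \<zero>\<^bsub>regular_copy \<phi> B\<^esub>"
      using b by (intro bexI[of _ "\<phi> (\<ominus>\<^bsub>B\<^esub> b)"]) (auto simp: simps)
  qed (auto simp: simps B.a_ac)
  then show ?thesis
    by (intro left_module.intro left_module_axioms.intro assms(1))
      (auto simp: simps B.l_distr B.r_distr B.m_assoc)
qed

text \<open>The copy of 1 generates: \<open>b\<close> times it is the copy of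
  \<open>b\<close>.\<close>

lemma finitely_generated_regular_copy:
  assumes "ring B" "inj_on \<phi> (carrier B)"
  shows "finitely_generated B (regular_copy \<phi> B)"
proof -
  interpret B: ring B by fact
  interpret M: left_module B "regular_copy \<phi> B"
    using assms by (rule left_module_regular_copy)
  note simps = regular_copy_simps[OF assms(2)]
  let ?M = "regular_copy \<phi> B"
  have "submodule (carrier ?M) B ?M"
    using group.subgroup_self[OF M.a_group] by (simp add: submodule_iff M.smult_closed)
  moreover have "carrier ?M \<subseteq> N" if "submodule N B ?M" "\<phi> \<one>\<^bsub>B\<^esub> \<in> N" for N
  proof
    fix x assume "x \<in> carrier ?M"
    then obtain b where b: "b \<in> carrier B" "x = \<phi> b"
      by (auto simp: simps)
    then have "b \<odot>\<^bsub>?M\<^esub> \<phi> \<one>\<^bsub>B\<^esub> \<in> N"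
      using that by (simp add: submodule_iff)
    then show "x \<in> N"
      using b by (simp add: simps)
  qed
  moreover have "{\<phi> \<one>\<^bsub>B\<^esub>} \<subseteq> carrier ?M"
    by (simp add: simps)
  ultimately show ?thesis
    unfolding finitely_generated_def by (intro exI[of _ "{\<phi> \<one>\<^bsub>B\<^esub>}"]) auto
qed

text \<open>The element r 1 acts on the copy as \<open>r\<close> acts on \<open>B\<close>, so
  torsion-freeness carries over.\<close>

lemma regular_copy_in_mod_tf:
  assumes "assoc_algebra R B" "torsion_free R B" "inj_on \<phi> (carrier B)"
  shows "regular_copy \<phi> B \<in> mod_tf R B"
proof -
  interpret B: ring B using assms(1) by (simp add: assoc_algebra_def)
  interpret RB: assoc_algebra R B by fact
  note simps = regular_copy_simps[OF assms(3)]
  have "torsion_free R (base_module B (regular_copy \<phi> B))"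
    unfolding torsion_free_def base_module_def
  proof (intro ballI impI)
    fix r x assume r: "r \<in> carrier R" and "x \<in> carrier (restrict_scalars (\<lambda>r. r \<odot>\<^bsub>B\<^esub> \<one>\<^bsub>B\<^esub>) (regular_copy \<phi> B))"
      and eq: "r \<odot>\<^bsub>restrict_scalars (\<lambda>r. r \<odot>\<^bsub>B\<^esub> \<one>\<^bsub>B\<^esub>) (regular_copy \<phi> B)\<^esub> x =
        \<zero>\<^bsub>restrict_scalars (\<lambda>r. r \<odot>\<^bsub>B\<^esub> \<one>\<^bsub>B\<^esub>) (regular_copy \<phi> B)\<^esub>"
    then obtain b where b: "b \<in> carrier B" "x = \<phi> b"
      by (auto simp: simps)
    have "\<phi> (r \<odot>\<^bsub>B\<^esub> b) = \<phi> \<zero>\<^bsub>B\<^esub>"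
      using eq r b by (simp add: simps RB.smult_assoc2)
    then have "r \<odot>\<^bsub>B\<^esub> b = \<zero>\<^bsub>B\<^esub>"
      using r b by (intro inj_onD[OF assms(3)]) auto
    then show "r = \<zero>\<^bsub>R\<^esub> \<or> x = \<zero>\<^bsub>restrict_scalars (\<lambda>r. r \<odot>\<^bsub>B\<^esub> \<one>\<^bsub>B\<^esub>) (regular_copy \<phi> B)\<^esub>"
      using assms(2) r b by (auto simp: torsion_free_def simps)
  qed
  then show ?thesis
    using assms B.ring_axioms left_module_regular_copy finitely_generated_regular_copy
    by (auto simp: mod_tf_def mod_f_def)
qed

lemma subgroup_regular_copy:
  assumes "ring B" "inj_on \<phi> (carrier B)" "subgroup D (add_monoid B)"
  shows "subgroup (\<phi> ` D) (add_monoid (regular_copy \<phi> B))"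
proof -
  interpret B: ring B by fact
  interpret M: left_module B "regular_copy \<phi> B"
    using assms(1,2) by (rule left_module_regular_copy)
  interpret group_hom "add_monoid B" "add_monoid (regular_copy \<phi> B)" \<phi>
    using B.a_group M.a_group
    by (auto simp: group_hom_def group_hom_axioms_def hom_def regular_copy_simps[OF assms(2)])
  show ?thesis
    using subgroup_img_is_subgroup[OF assms(3)] .
qed

lemma subset_stable_eq_carrier:
  assumes "ring B" "inj_on \<phi> (carrier B)" "D \<subseteq> carrier B" "\<one>\<^bsub>B\<^esub> \<in> D"
    and "submodule (\<phi> ` D) B (regular_copy \<phi> B)"
  shows "D = carrier B"
proof -
  interpret B: ring B by fact
  have "b \<in> D" if b: "b \<in> carrier B" for b
  proof -
    have "b \<odot>\<^bsub>regular_copy \<phi> B\<^esub> \<phi> \<one>\<^bsub>B\<^esub> \<in> \<phi> ` D"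
      using assms(4,5) b by (simp add: submodule_iff)
    then have "\<phi> b \<in> \<phi> ` D"
      using b by (simp add: regular_copy_simps[OF assms(2)])
    then show ?thesis
      using inj_on_image_mem_iff[OF assms(2) b assms(3)] by simp
  qed
  then show ?thesis
    using assms(3) by blast
qed

text \<open>Restriction of scalars does not alter maps, so the lift of \<open>g\<close> can be
  \<open>g\<close> itself once it is seen to be \<open>B\<close>-linear.\<close>

lemma full_onI:
  assumes "\<And>M M' g b x. \<lbrakk>M \<in> C; M' \<in> C; g \<in> module_hom A (restrict_scalars f M) (restrict_scalars f M');
      b \<in> carrier B; x \<in> carrier M\<rbrakk> \<Longrightarrow> g (b \<odot>\<^bsub>M\<^esub> x) = b \<odot>\<^bsub>M'\<^esub> g x"
  shows "full_on A B f C"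
  unfolding full_on_def
proof (intro ballI)
  fix M M' g assume *: "M \<in> C" "M' \<in> C" "g \<in> module_hom A (restrict_scalars f M) (restrict_scalars f M')"
  then have "g \<in> module_hom B M M'"
    using assms[OF *] unfolding module_hom_restrict_scalars_iff by (simp add: module_hom_def)
  then show "\<exists>h\<in>module_hom B M M'. \<forall>x\<in>carrier M. h x = g x"
    by blast
qed

section \<open>Consequences of dominance for a homomorphism of algebras over a domain\<close>

locale algebra_map = R?: domain R + AR: assoc_algebra R A + BR: assoc_algebra R B
  for R :: "('r, 'x) ring_scheme" and A :: "('r, 'a) module" and B :: "('r, 'b) module" +
  fixes f :: "'a \<Rightarrow> 'b"
  assumes hom: "f \<in> algebra_hom R A B"
begin

lemma ring_A: "ring A" and ring_B: "ring B"
  using AR.assoc_algebra_axioms BR.assoc_algebra_axioms by (simp_all add: assoc_algebra_def)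

lemma ring_hom: "f \<in> ring_hom A B"
  using hom by (simp add: algebra_hom_def)

lemma hom_closed: "a \<in> carrier A \<Longrightarrow> f a \<in> carrier B"
  using ring_hom by (rule ring_hom_closed)

lemma one_closed': "\<one>\<^bsub>A\<^esub> \<in> carrier A" "\<one>\<^bsub>B\<^esub> \<in> carrier B"
  using ring_A ring_B by (simp_all add: ring.ring_simprules)

text \<open>This makes the \<open>R\<close>-module structure of a \<open>B\<close>-module agree with
  that of its restriction to \<open>A\<close>.\<close>

lemma hom_scalar: "r \<in> carrier R \<Longrightarrow> f (r \<odot>\<^bsub>A\<^esub> \<one>\<^bsub>A\<^esub>) = r \<odot>\<^bsub>B\<^esub> \<one>\<^bsub>B\<^esub>"
  using hom ring_hom_one[OF ring_hom] one_closed' by (simp add: algebra_hom_def)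

lemma scalar_mult: "r \<in> carrier R \<Longrightarrow> b \<in> carrier B \<Longrightarrow> (r \<odot>\<^bsub>B\<^esub> \<one>\<^bsub>B\<^esub>) \<otimes>\<^bsub>B\<^esub> b = r \<odot>\<^bsub>B\<^esub> b"
  using BR.smult_assoc2[of r "\<one>\<^bsub>B\<^esub>" b] one_closed' ring_B by (simp add: ring.ring_simprules)

lemma scalar_smult:
  assumes "left_module B M" "r \<in> carrier R" "b \<in> carrier B" "x \<in> carrier M"
  shows "(r \<odot>\<^bsub>B\<^esub> \<one>\<^bsub>B\<^esub>) \<odot>\<^bsub>M\<^esub> (b \<odot>\<^bsub>M\<^esub> x) = (r \<odot>\<^bsub>B\<^esub> b) \<odot>\<^bsub>M\<^esub> x"
  using left_module.smult_assoc1[OF assms(1) BR.smult_closed[OF assms(2) one_closed'(2)] assms(3,4)]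
    scalar_mult[OF assms(2,3)] by simp

lemma saturated_restrict_scalars_iff:
  assumes "left_module B M"
  shows "saturated_submodule R N A (restrict_scalars f M) \<longleftrightarrow> submodule N A (restrict_scalars f M) \<and>
    (\<forall>r\<in>carrier R - {\<zero>\<^bsub>R\<^esub>}. \<forall>x\<in>carrier M. (r \<odot>\<^bsub>B\<^esub> \<one>\<^bsub>B\<^esub>) \<odot>\<^bsub>M\<^esub> x \<in> N \<longrightarrow> x \<in> N)"
  using saturated_submodule_iff[OF AR.assoc_algebra_axioms left_module_restrict_scalars[OF ring_A ring_hom assms]]
  by (simp add: hom_scalar)

text \<open>The factor r is cancelled modulo \<open>N\<close>, by saturation, and not in
  \<open>M\<close>. Hence the class \<open>C\<close> can be left open, to serve both for
  \<open>mod_tf\<close> and for \<open>mod_f\<close>.\<close>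

lemma closed_under_saturated:
  assumes "torsion_cokernel R A B f" "C \<subseteq> mod_f B"
  shows "image_closed_under (\<lambda>N. saturated_submodule R N A) f B C"
  unfolding image_closed_under_iff
proof (intro ballI allI impI)
  fix M N assume "M \<in> C" and N: "saturated_submodule R N A (restrict_scalars f M)"
  then have M: "left_module B M"
    using assms(2) by (auto simp: mod_f_def)
  have sub: "submodule N A (restrict_scalars f M)"
    and sat: "\<And>r x. \<lbrakk>r \<in> carrier R - {\<zero>\<^bsub>R\<^esub>}; x \<in> carrier M; (r \<odot>\<^bsub>B\<^esub> \<one>\<^bsub>B\<^esub>) \<odot>\<^bsub>M\<^esub> x \<in> N\<rbrakk> \<Longrightarrow> x \<in> N"
    using N unfolding saturated_restrict_scalars_iff[OF M] by auto
  have "b \<odot>\<^bsub>M\<^esub> x \<in> N" if b: "b \<in> carrier B" and x: "x \<in> N" for b x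
  proof -
    have xM: "x \<in> carrier M"
      using sub x subgroup.mem_carrier[of N "add_monoid M" x] by (simp add: submodule_restrict_scalars_iff)
    obtain r a where r: "r \<in> carrier R - {\<zero>\<^bsub>R\<^esub>}" "a \<in> carrier A" "r \<odot>\<^bsub>B\<^esub> b = f a"
      using assms(1) b unfolding torsion_cokernel_def by blast
    have "f a \<odot>\<^bsub>M\<^esub> x \<in> N"
      using sub r x by (simp add: submodule_restrict_scalars_iff)
    then have "(r \<odot>\<^bsub>B\<^esub> \<one>\<^bsub>B\<^esub>) \<odot>\<^bsub>M\<^esub> (b \<odot>\<^bsub>M\<^esub> x) \<in> N"
      using scalar_smult[OF M _ b xM] r by simp
    with r(1) left_module.smult_closed[OF M b xM] show ?thesis
      by (rule sat)
  qed
  then show "submodule N B M"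
    using sub unfolding submodule_restrict_scalars_iff by (simp add: submodule_iff)
qed

lemma full_on_mod_tf:
  assumes "torsion_cokernel R A B f"
  shows "full_on A B f (mod_tf R B :: ('b, 'm) module set)"
proof (rule full_onI)
  fix M M' :: "('b, 'm) module" and g b x
  assume M: "M \<in> mod_tf R B" and M': "M' \<in> mod_tf R B"
    and g: "g \<in> module_hom A (restrict_scalars f M) (restrict_scalars f M')"
    and b: "b \<in> carrier B" and x: "x \<in> carrier M"
  interpret M: left_module B M using M by (simp add: mod_tf_def mod_f_def)
  interpret M': left_module B M' using M' by (simp add: mod_tf_def mod_f_def)
  have g_closed: "g y \<in> carrier M'" if "y \<in> carrier M" for y
    using module_hom_closed[OF g] that by auto
  have g_lin: "g (f a \<odot>\<^bsub>M\<^esub> y) = f a \<odot>\<^bsub>M'\<^esub> g y" if "a \<in> carrier A" "y \<in> carrier M" for a y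
    using module_hom_smult[OF g] that by simp
  obtain r a where r: "r \<in> carrier R - {\<zero>\<^bsub>R\<^esub>}" "a \<in> carrier A" "r \<odot>\<^bsub>B\<^esub> b = f a"
    using assms b unfolding torsion_cokernel_def by blast
  let ?r = "r \<odot>\<^bsub>B\<^esub> \<one>\<^bsub>B\<^esub>"
  have r': "?r \<in> carrier B" "r \<odot>\<^bsub>A\<^esub> \<one>\<^bsub>A\<^esub> \<in> carrier A" "f (r \<odot>\<^bsub>A\<^esub> \<one>\<^bsub>A\<^esub>) = ?r"
    using r(1) one_closed' by (auto simp: hom_scalar)
  have bx: "b \<odot>\<^bsub>M\<^esub> x \<in> carrier M" "g (b \<odot>\<^bsub>M\<^esub> x) \<in> carrier M'" "b \<odot>\<^bsub>M'\<^esub> g x \<in> carrier M'"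
    using b x g_closed by (auto simp: M.smult_closed M'.smult_closed)
  \<comment> \<open>The scalar r passes through \<open>g\<close> because it comes from
    \<open>A\<close>; inside, r b is replaced by f(a), which passes through as well.\<close>
  have "?r \<odot>\<^bsub>M'\<^esub> g (b \<odot>\<^bsub>M\<^esub> x) = g (?r \<odot>\<^bsub>M\<^esub> (b \<odot>\<^bsub>M\<^esub> x))"
    using g_lin[OF r'(2) bx(1)] r'(3) by simp
  also have "\<dots> = g (f a \<odot>\<^bsub>M\<^esub> x)"
    using scalar_smult[OF M.left_module_axioms _ b x] r by simp
  also have "\<dots> = f a \<odot>\<^bsub>M'\<^esub> g x"
    using r x by (simp add: g_lin)
  also have "\<dots> = ?r \<odot>\<^bsub>M'\<^esub> (b \<odot>\<^bsub>M'\<^esub> g x)"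
    using scalar_smult[OF M'.left_module_axioms _ b g_closed[OF x]] r by simp
  finally have "?r \<odot>\<^bsub>M'\<^esub> (g (b \<odot>\<^bsub>M\<^esub> x) \<ominus>\<^bsub>M'\<^esub> b \<odot>\<^bsub>M'\<^esub> g x) = \<zero>\<^bsub>M'\<^esub>"
    unfolding M'.smult_minus[OF r'(1) bx(2,3)]
    using M'.smult_closed[OF r'(1) bx(3)] by (simp add: a_minus_def M'.r_neg)
  moreover have "g (b \<odot>\<^bsub>M\<^esub> x) \<ominus>\<^bsub>M'\<^esub> b \<odot>\<^bsub>M'\<^esub> g x \<in> carrier M'"
    using bx by simp
  \<comment> \<open>The factor r is cancelled by torsion-freeness of the target
    \<open>M'\<close>.\<close>
  ultimately have "g (b \<odot>\<^bsub>M\<^esub> x) \<ominus>\<^bsub>M'\<^esub> b \<odot>\<^bsub>M'\<^esub> g x = \<zero>\<^bsub>M'\<^esub>"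
    using M' r(1) by (auto simp: mod_tf_def torsion_free_def base_module_def)
  then show "g (b \<odot>\<^bsub>M\<^esub> x) = b \<odot>\<^bsub>M'\<^esub> g x"
    using bx by (simp add: a_minus_def M'.add.inv_solve_right')
qed

section \<open>The image of \<open>f\<close>, its saturation, and the converses\<close>

lemma module_hom: "f \<in> module_hom R A B"
  using hom by (rule algebra_hom_module_hom)

lemma image_subgroup: "subgroup (f ` carrier A) (add_monoid B)"
  using additive_subgroup_module_hom_image[OF ring.is_abelian_group[OF ring_A] ring.is_abelian_group[OF ring_B] module_hom]
  by (rule additive_subgroup.a_subgroup)

lemma image_stable: "a \<in> carrier A \<Longrightarrow> b \<in> f ` carrier A \<Longrightarrow> f a \<otimes>\<^bsub>B\<^esub> b \<in> f ` carrier A"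
  by (auto simp: ring.ring_simprules[OF ring_A] simp flip: ring_hom_mult[OF ring_hom])

lemma one_in_image: "\<one>\<^bsub>B\<^esub> \<in> f ` carrier A"
  using ring_hom_one[OF ring_hom] one_closed' by (metis imageI)

lemma surj_if_closed:
  fixes \<phi> :: "'b \<Rightarrow> 'm"
  assumes "torsion_free R B" "inj_on \<phi> (carrier B)"
    and closed: "image_closed_under (\<lambda>N. submodule N A) f B (mod_tf R B :: ('b, 'm) module set)"
  shows "f ` carrier A = carrier B"
proof (rule subset_stable_eq_carrier[OF ring_B assms(2)])
  have "submodule (\<phi> ` f ` carrier A) A (restrict_scalars f (regular_copy \<phi> B))"
    using subgroup_regular_copy[OF ring_B assms(2) image_subgroup] image_stable hom_closed
    by (auto simp: submodule_restrict_scalars_iff regular_copy_simps[OF assms(2)])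
  then show "submodule (\<phi> ` f ` carrier A) B (regular_copy \<phi> B)"
    using closed regular_copy_in_mod_tf[OF BR.assoc_algebra_axioms assms(1,2)]
    unfolding image_closed_under_iff by blast
qed (use one_in_image hom_closed in auto)

text \<open>The preimage in \<open>B\<close> of the torsion submodule of B/f(A), which is the
  smallest saturated submodule containing f(A).\<close>

definition saturated_image :: "'b set" where
  "saturated_image = {b \<in> carrier B. \<exists>r\<in>carrier R - {\<zero>\<^bsub>R\<^esub>}. r \<odot>\<^bsub>B\<^esub> b \<in> f ` carrier A}"

lemma saturated_imageI:
  "\<lbrakk>b \<in> carrier B; r \<in> carrier R; r \<noteq> \<zero>\<^bsub>R\<^esub>; r \<odot>\<^bsub>B\<^esub> b \<in> f ` carrier A\<rbrakk> \<Longrightarrow> b \<in> saturated_image"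
  by (auto simp: saturated_image_def)

lemma saturated_imageE:
  assumes "b \<in> saturated_image"
  obtains r where "b \<in> carrier B" "r \<in> carrier R" "r \<noteq> \<zero>\<^bsub>R\<^esub>" "r \<odot>\<^bsub>B\<^esub> b \<in> f ` carrier A"
  using assms by (auto simp: saturated_image_def)

lemma image_smult: "r \<in> carrier R \<Longrightarrow> b \<in> f ` carrier A \<Longrightarrow> r \<odot>\<^bsub>B\<^esub> b \<in> f ` carrier A"
  by (auto simp flip: module_hom_smult[OF module_hom])

text \<open>For a sum, the product of the two multipliers works: it brings both terms into f(A), and
  it is nonzero because \<open>R\<close> is a domain.\<close>

lemma saturated_image_subgroup: "subgroup saturated_image (add_monoid B)"
proof -
  interpret F: additive_subgroup "f ` carrier A" B
    using image_subgroup by (rule additive_subgroupI)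
  interpret BB: abelian_group B
    using ring_B by (rule ring.is_abelian_group)
  have "x \<oplus>\<^bsub>B\<^esub> y \<in> saturated_image" if x: "x \<in> saturated_image" and y: "y \<in> saturated_image" for x y
  proof -
    obtain r where r: "x \<in> carrier B" "r \<in> carrier R" "r \<noteq> \<zero>\<^bsub>R\<^esub>" "r \<odot>\<^bsub>B\<^esub> x \<in> f ` carrier A"
      using x by (rule saturated_imageE)
    obtain s where s: "y \<in> carrier B" "s \<in> carrier R" "s \<noteq> \<zero>\<^bsub>R\<^esub>" "s \<odot>\<^bsub>B\<^esub> y \<in> f ` carrier A"
      using y by (rule saturated_imageE)
    have rs: "r \<otimes>\<^bsub>R\<^esub> s = s \<otimes>\<^bsub>R\<^esub> r" "r \<otimes>\<^bsub>R\<^esub> s \<in> carrier R"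
      using r s by (simp_all add: R.m_comm)
    have "(r \<otimes>\<^bsub>R\<^esub> s) \<odot>\<^bsub>B\<^esub> x = s \<odot>\<^bsub>B\<^esub> (r \<odot>\<^bsub>B\<^esub> x)"
      unfolding rs(1) using r s by (simp add: BR.smult_assoc1)
    moreover have "(r \<otimes>\<^bsub>R\<^esub> s) \<odot>\<^bsub>B\<^esub> y = r \<odot>\<^bsub>B\<^esub> (s \<odot>\<^bsub>B\<^esub> y)"
      using r s by (simp add: BR.smult_assoc1)
    ultimately have "(r \<otimes>\<^bsub>R\<^esub> s) \<odot>\<^bsub>B\<^esub> (x \<oplus>\<^bsub>B\<^esub> y) \<in> f ` carrier A"
      using r s rs by (simp add: BR.smult_r_distr image_smult)
    then show ?thesis
      using r s rs R.integral by (intro saturated_imageI[of _ "r \<otimes>\<^bsub>R\<^esub> s"]) auto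
  qed
  moreover have "\<ominus>\<^bsub>B\<^esub> x \<in> saturated_image" if x: "x \<in> saturated_image" for x
  proof -
    obtain r where r: "x \<in> carrier B" "r \<in> carrier R" "r \<noteq> \<zero>\<^bsub>R\<^esub>" "r \<odot>\<^bsub>B\<^esub> x \<in> f ` carrier A"
      using x by (rule saturated_imageE)
    then show ?thesis
      by (intro saturated_imageI[of _ r]) (auto simp: BR.smult_r_minus)
  qed
  moreover have "\<zero>\<^bsub>B\<^esub> \<in> saturated_image"
    using F.zero_closed by (intro saturated_imageI[of _ "\<one>\<^bsub>R\<^esub>"]) auto
  ultimately show ?thesis
    by (unfold_locales) (auto simp: saturated_image_def a_inv_def[symmetric])
qed

text \<open>Closure forces \<open>saturated_image\<close> to be all of \<open>B\<close>, and by its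
  definition this says that the cokernel is torsion.\<close>

lemma torsion_cokernel_if_closed:
  fixes \<phi> :: "'b \<Rightarrow> 'm"
  assumes "torsion_free R B" "inj_on \<phi> (carrier B)"
    and closed: "image_closed_under (\<lambda>N. saturated_submodule R N A) f B (mod_tf R B :: ('b, 'm) module set)"
  shows "torsion_cokernel R A B f"
proof -
  let ?M = "regular_copy \<phi> B"
  interpret B: ring B by (rule ring_B)
  note simps = regular_copy_simps[OF assms(2)]
  have sub: "saturated_image \<subseteq> carrier B"
    by (auto simp: saturated_image_def)
  have "f a \<otimes>\<^bsub>B\<^esub> b \<in> saturated_image" if a: "a \<in> carrier A" and b: "b \<in> saturated_image" for a b
  proof -
    obtain r where r: "b \<in> carrier B" "r \<in> carrier R" "r \<noteq> \<zero>\<^bsub>R\<^esub>" "r \<odot>\<^bsub>B\<^esub> b \<in> f ` carrier A"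
      using b by (rule saturated_imageE)
    \<comment> \<open>Scalars from \<open>R\<close> act centrally on \<open>B\<close>, so the
      multiplier of \<open>b\<close> also serves for f(a) b.\<close>
    have "r \<odot>\<^bsub>B\<^esub> (f a \<otimes>\<^bsub>B\<^esub> b) = f a \<otimes>\<^bsub>B\<^esub> (r \<odot>\<^bsub>B\<^esub> b)"
      using r a hom_closed by (simp add: BR.smult_assoc3)
    then have "r \<odot>\<^bsub>B\<^esub> (f a \<otimes>\<^bsub>B\<^esub> b) \<in> f ` carrier A"
      using image_stable[OF a r(4)] by simp
    then show ?thesis
      using r a hom_closed by (intro saturated_imageI[of _ r]) auto
  qed
  then have "submodule (\<phi> ` saturated_image) A (restrict_scalars f ?M)"
    using subgroup_regular_copy[OF ring_B assms(2) saturated_image_subgroup] sub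
    by (auto simp: submodule_restrict_scalars_iff simps)
  \<comment> \<open>Saturating twice adds nothing: multipliers \<open>r\<close> and s combine to the
    nonzero product s r.\<close>
  moreover have "x \<in> \<phi> ` saturated_image"
    if r: "r \<in> carrier R - {\<zero>\<^bsub>R\<^esub>}" and x: "x \<in> carrier ?M" and rx: "(r \<odot>\<^bsub>B\<^esub> \<one>\<^bsub>B\<^esub>) \<odot>\<^bsub>?M\<^esub> x \<in> \<phi> ` saturated_image" for r x
  proof -
    obtain b where b: "b \<in> carrier B" "x = \<phi> b"
      using x by (auto simp: simps)
    have "\<phi> (r \<odot>\<^bsub>B\<^esub> b) \<in> \<phi> ` saturated_image"
      using rx r b by (simp add: simps scalar_mult)
    then have "r \<odot>\<^bsub>B\<^esub> b \<in> saturated_image"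
      using inj_on_image_mem_iff[OF assms(2) _ sub, of "r \<odot>\<^bsub>B\<^esub> b"] r b by auto
    then obtain s where s: "s \<in> carrier R" "s \<noteq> \<zero>\<^bsub>R\<^esub>" "s \<odot>\<^bsub>B\<^esub> (r \<odot>\<^bsub>B\<^esub> b) \<in> f ` carrier A"
      by (rule saturated_imageE)
    then have "(s \<otimes>\<^bsub>R\<^esub> r) \<odot>\<^bsub>B\<^esub> b \<in> f ` carrier A"
      using r b by (simp add: BR.smult_assoc1)
    then have "b \<in> saturated_image"
      using r s b R.integral by (intro saturated_imageI[of _ "s \<otimes>\<^bsub>R\<^esub> r"]) auto
    then show ?thesis
      using b by blast
  qed
  ultimately have "saturated_submodule R (\<phi> ` saturated_image) A (restrict_scalars f ?M)"
    unfolding saturated_restrict_scalars_iff[OF left_module_regular_copy[OF ring_B assms(2)]] by blast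
  then have "submodule (\<phi> ` saturated_image) B ?M"
    using closed regular_copy_in_mod_tf[OF BR.assoc_algebra_axioms assms(1,2)]
    unfolding image_closed_under_iff by blast
  moreover have "\<one>\<^bsub>B\<^esub> \<in> saturated_image"
    using one_in_image by (intro saturated_imageI[of _ "\<one>\<^bsub>R\<^esub>"]) auto
  ultimately have "saturated_image = carrier B"
    using subset_stable_eq_carrier[OF ring_B assms(2) sub] by blast
  then show ?thesis
    unfolding torsion_cokernel_def saturated_image_def by blast
qed

text \<open>Every element of \<open>B\<close> is some f(a), so stability under \<open>A\<close> and
  under \<open>B\<close> are the same condition.\<close>

lemma closed_under_submodules:
  assumes "f ` carrier A = carrier B"
  shows "image_closed_under (\<lambda>N. submodule N A) f B C"
  unfolding image_closed_under_iff submodule_restrict_scalars_iff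
  using assms[symmetric] by (auto simp: submodule_iff)

lemma full_on_surj:
  assumes "f ` carrier A = carrier B"
  shows "full_on A B f C"
proof (rule full_onI)
  fix M M' :: "('b, 'm) module" and g b x
  assume g: "g \<in> module_hom A (restrict_scalars f M) (restrict_scalars f M')"
    and "b \<in> carrier B" and x: "x \<in> carrier M"
  then obtain a where "a \<in> carrier A" "b = f a"
    using assms by blast
  then show "g (b \<odot>\<^bsub>M\<^esub> x) = b \<odot>\<^bsub>M'\<^esub> g x"
    using module_hom_smult[OF g] x by simp
qed

end

theorem proposition2p2:
  fixes R :: "'r ring" and K :: "('r, 'k) module"
    and A :: "('r, 'a) module" and B :: "('r, 'b) module"
    and f :: "'a \<Rightarrow> 'b"
  assumes "noetherian_domain R" and "quotient_field R K"
    and "assoc_algebra R A" and "torsion_free R A"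
    and "assoc_algebra R B" and "torsion_free R B"
    and "f \<in> algebra_hom R A B"
    and "finitely_generated R B"
    \<comment> \<open>The type \<open>'m\<close> is large enough to contain a copy of every finitely generated \<open>B\<close>-module:
      such a module is a quotient of some \<open>B\<^sup>n\<close>.\<close>
    and "lists (carrier B) \<lesssim> (UNIV :: 'm set)"
  shows
    "((image_closed_under (\<lambda>N. saturated_submodule R N A) f B (mod_tf R B :: ('b, 'm) module set)
        \<longleftrightarrow> dominant R K A B f) \<and>
      (dominant R K A B f \<longrightarrow>
        image_closed_under (\<lambda>N. saturated_submodule R N A) f B (mod_f B :: ('b, 'm) module set) \<and>
        full_on A B f (mod_tf R B :: ('b, 'm) module set))) \<and>
     ((image_closed_under (\<lambda>N. submodule N A) f B (mod_tf R B :: ('b, 'm) module set)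
        \<longleftrightarrow> f ` carrier A = carrier B) \<and>
      (f ` carrier A = carrier B \<longrightarrow>
        full_on A B f (mod_f B :: ('b, 'm) module set)))"
proof -
  have R: "domain R"
    using assms(1) by (rule noetherian_domain.axioms)
  interpret algebra_map R A B f
    by (rule algebra_map.intro[OF R assms(3,5) algebra_map_axioms.intro[OF assms(7)]])
  obtain \<psi> :: "'b list \<Rightarrow> 'm" where "inj_on \<psi> (lists (carrier B))"
    using assms(9) unfolding lepoll_def by blast
  \<comment> \<open>One-element lists embed \<open>B\<close> into lists over \<open>B\<close>, and
    thereby into \<open>'m\<close>.\<close>
  then have inj: "inj_on (\<lambda>b. \<psi> [b]) (carrier B)"
    by (auto intro!: inj_onI dest: inj_onD)
  have dominant: "dominant R K A B f \<longleftrightarrow> torsion_cokernel R A B f"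
    using dominant_iff_torsion_cokernel[OF R assms(2) AR.module_axioms BR.module_axioms module_hom] .
  have tf: "mod_tf R B \<subseteq> (mod_f B :: ('b, 'm) module set)"
    unfolding mod_tf_def by (rule Collect_restrict)
  show ?thesis
    unfolding dominant
  proof (intro conjI iffI impI)
    assume tors: "torsion_cokernel R A B f"
    show "image_closed_under (\<lambda>N. saturated_submodule R N A) f B (mod_tf R B :: ('b, 'm) module set)"
      using tors tf by (rule closed_under_saturated)
    show "image_closed_under (\<lambda>N. saturated_submodule R N A) f B (mod_f B :: ('b, 'm) module set)"
      using tors subset_refl by (rule closed_under_saturated)
    show "full_on A B f (mod_tf R B :: ('b, 'm) module set)"
      using tors by (rule full_on_mod_tf)
  next
    assume surj: "f ` carrier A = carrier B"
    show "image_closed_under (\<lambda>N. submodule N A) f B (mod_tf R B :: ('b, 'm) module set)"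
      using surj by (rule closed_under_submodules)
    show "full_on A B f (mod_f B :: ('b, 'm) module set)"
      using surj by (rule full_on_surj)
  \<comment> \<open>What is left are the two implications from closure to a property of
    \<open>f\<close>, both tested on the copy of \<open>B\<close> in \<open>'m\<close>.\<close>
  qed (rule torsion_cokernel_if_closed[OF assms(6) inj] surj_if_closed[OF assms(6) inj], assumption)+
qed

end
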